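(* Let $\Gamma$ be a locally compact Hausdorff group, let $\Lambda\subseteq\Gamma$ be a closed subgroup that almost commutes with compacts, let $R$ be a commutative ring, let $n\in\mathbb{N}$, and let $\chi\colon\Gamma\to\mathbb{R}$ be a character that vanishes on $\Lambda$. If $\Lambda$ is of type $\mathrm{CP}_n(R)$, then: (1) For every $k\le n$, if the filtration $(\Gamma_\chi\cdot\operatorname{E}F)_{F\in\mathcal{C}(\Gamma/\Lambda)}$ of $\operatorname{E}(\Gamma/\Lambda)$ is essentially $(k-1)$-acyclic over $R$, then $\chi\in\Sigma^k_{\mathrm{top}}(\Gamma;R)$. (2) For every $k\le n+1$, if $\chi\in\Sigma^k_{\mathrm{top}}(\Gamma;R)$, then the filtration $(\Gamma_\chi\cdot\operatorname{E}F)_{F\in\mathcal{C}(\Gamma/\Lambda)}$ is essentially $(k-1)$-acyclic over $R$.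
   Context: Conventions: $\mathbb{N}$ includes $0$; rings have a unit; $k$ ranges over natural numbers; $\Gamma/\Lambda$ is the space of left cosets with the quotient topology and the left multiplication action of $\Gamma$; $\Lambda$ carries the subspace topology. A closed subgroup $\Lambda$ of a locally compact Hausdorff group $\Gamma$ almost commutes with compacts if for every compact $C\subseteq\Gamma$ there is a compact $C'\subseteq\Gamma$ with $C\Lambda\subseteq\Lambda C'$ and $\Lambda C\subseteq C'\Lambda$. For a set $X$, $\operatorname{E}X$ is the simplicial set whose $k$-simplices are the tuples $(x_0,\dots,x_k)\in X^{k+1}$, the $i$-th face (degeneracy) map deleting (doubling) the $i$-th entry; a group action on $X$ induces one on $\operatorname{E}X$. For a topological space $X$, $\mathcal{C}(X)$ is the poset of compact subspaces of $X$ ordered by inclusion. A filtration of a simplicial set $Y$ over a directed poset $A$ is a family of simplicial subsets $(Y_\alpha)_{\alpha\in A}$ with union $Y$ and $Y_\alpha\subseteq Y_\beta$ for $\alpha\le\beta$. It is essentially $m$-acyclic over $R$ if for all $0\le k\le m$ and every $\alpha$ there is $\beta\ge\alpha$ such that the inclusion-induced map $\tilde{\operatorname{H}}_k(Y_\alpha;R)\to\tilde{\operatorname{H}}_k(Y_\beta;R)$ on reduced homology (computed from the augmented simplicial chain complex) is zero (vacuous for $m=-1$). For a locally compact Hausdorff group $G$, a character is a continuous homomorphism $\chi\colon G\to\mathbb{R}$, and $G_\chi=\chi^{-1}([0,+\infty))$. If $G$ acts on a set $X$ and $C\subseteq X$, then $G_\chi\cdot\operatorname{E}C=\bigcup_{g\in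 G_\chi}g\cdot\operatorname{E}C\subseteq\operatorname{E}X$. By definition $\chi\in\Sigma^k_{\mathrm{top}}(G;R)$ iff the filtration $(G_\chi\cdot\operatorname{E}C)_{C\in\mathcal{C}(G)}$ of $\operatorname{E}G$ (with $G$ acting on itself by left multiplication) is essentially $(k-1)$-acyclic over $R$. $G$ is of type $\mathrm{CP}_n(R)$ if $(G\cdot\operatorname{E}C)_{C\in\mathcal{C}(G)}$ is essentially $(n-1)$-acyclic over $R$. *)

theory Defs
  imports "HOL-Analysis.Analysis" "HOL-Algebra.Ring" "HOL-Algebra.Left_Coset"
begin

section \<open>Topological groups\<close>

definition topological_group :: "('g, 'm) monoid_scheme \<Rightarrow> 'g topology \<Rightarrow> bool" where
  "topological_group G T \<longleftrightarrow>
     group G \<and> topspace T = carrier G \<and>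
     continuous_map (prod_topology T T) T (\<lambda>(x, y). x \<otimes>\<^bsub>G\<^esub> y) \<and>
     continuous_map T T (\<lambda>x. inv\<^bsub>G\<^esub> x)"

definition locally_compact_Hausdorff_group :: "('g, 'm) monoid_scheme \<Rightarrow> 'g topology \<Rightarrow> bool" where
  "locally_compact_Hausdorff_group G T \<longleftrightarrow>
     topological_group G T \<and> locally_compact_space T \<and> Hausdorff_space T"

definition almost_commutes_with_compacts ::
    "('g, 'm) monoid_scheme \<Rightarrow> 'g topology \<Rightarrow> 'g set \<Rightarrow> bool" where
  "almost_commutes_with_compacts G T L \<longleftrightarrow>
     (\<forall>C. compactin T C \<longrightarrow>
        (\<exists>C'. compactin T C' \<and>
              C <#>\<^bsub>G\<^esub> L \<subseteq> L <#>\<^bsub>G\<^esub> C' \<and> L <#>\<^bsub>G\<^esub> C \<subseteq> C' <#>\<^bsub>G\<^esub> L))"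

definition real_add_group :: "real monoid" where
  "real_add_group = \<lparr>carrier = UNIV, mult = (+), one = 0\<rparr>"

definition character :: "('g, 'm) monoid_scheme \<Rightarrow> 'g topology \<Rightarrow> ('g \<Rightarrow> real) \<Rightarrow> bool" where
  "character G T chi \<longleftrightarrow> chi \<in> hom G real_add_group \<and> continuous_map T euclideanreal chi"

definition char_halfspace :: "('g, 'm) monoid_scheme \<Rightarrow> ('g \<Rightarrow> real) \<Rightarrow> 'g set" where
  "char_halfspace G chi = {g \<in> carrier G. chi g \<in> {0..}}"

definition quotient_topology :: "'a topology \<Rightarrow> ('a \<Rightarrow> 'b) \<Rightarrow> 'b topology" where
  "quotient_topology T q =
     topology (\<lambda>U. U \<subseteq> q ` topspace T \<and> openin T {x \<in> topspace T. q x \<in> U})"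

lemma openin_quotient_topology:
  "openin (quotient_topology T q) U \<longleftrightarrow>
     U \<subseteq> q ` topspace T \<and> openin T {x \<in> topspace T. q x \<in> U}"
proof -
  have "istopology (\<lambda>U. U \<subseteq> q ` topspace T \<and> openin T {x \<in> topspace T. q x \<in> U})"
    (is "istopology ?P")
    unfolding istopology_def
  proof (intro conjI allI impI)
    fix U V assume *: "?P U" "?P V"
    then show "U \<inter> V \<subseteq> q ` topspace T" by blast
    have eq: "{x \<in> topspace T. q x \<in> U \<inter> V} =
            {x \<in> topspace T. q x \<in> U} \<inter> {x \<in> topspace T. q x \<in> V}" by blast
    show "openin T {x \<in> topspace T. q x \<in> U \<inter> V}"
      unfolding eq using * by (intro openin_Int) blast+
  next
    fix K assume *: "\<forall>U\<in>K. ?P U"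
    then show "\<Union>K \<subseteq> q ` topspace T" by blast
    have eq: "{x \<in> topspace T. q x \<in> \<Union>K} = (\<Union>U\<in>K. {x \<in> topspace T. q x \<in> U})" by blast
    show "openin T {x \<in> topspace T. q x \<in> \<Union>K}"
      unfolding eq using * by (intro openin_Union) blast
  qed
  then show ?thesis by (simp add: quotient_topology_def)
qed

lemma topspace_quotient_topology: "topspace (quotient_topology T q) = q ` topspace T"
proof -
  have "{x \<in> topspace T. q x \<in> q ` topspace T} = topspace T" by blast
  then have "openin (quotient_topology T q) (q ` topspace T)"
    by (simp add: openin_quotient_topology)
  then show ?thesis
    by (meson openin_quotient_topology openin_subset openin_topspace subset_antisym)
qed

lemma quotient_map_quotient_topology: "quotient_map T (quotient_topology T q) q"
  by (auto simp: quotient_map_def topspace_quotient_topology openin_quotient_topology)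

definition left_coset_topology ::
    "('g, 'm) monoid_scheme \<Rightarrow> 'g topology \<Rightarrow> 'g set \<Rightarrow> 'g set topology" where
  "left_coset_topology G T L = quotient_topology T (\<lambda>x. x <#\<^bsub>G\<^esub> L)"

lemma topspace_left_coset_topology:
  "topspace T = carrier G \<Longrightarrow> topspace (left_coset_topology G T L) = lcosets\<^bsub>G\<^esub> L"
  by (auto simp: left_coset_topology_def topspace_quotient_topology LCOSETS_def)

section \<open>Simplicial sets\<close>

text \<open>The maps \<open>face Y n i\<close> and \<open>degen Y n i\<close> are meaningful on \<open>n\<close>-simplices for \<open>i \<le> n\<close>
  (with \<open>n > 0\<close> in the case of \<open>face\<close>).\<close>

record 's sset =
  simplices :: "nat \<Rightarrow> 's set"
  face :: "nat \<Rightarrow> nat \<Rightarrow> 's \<Rightarrow> 's"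
  degen :: "nat \<Rightarrow> nat \<Rightarrow> 's \<Rightarrow> 's"

definition simplicial_set :: "'s sset \<Rightarrow> bool" where
  "simplicial_set Y \<longleftrightarrow>
     (\<forall>n. \<forall>i\<le>Suc n. \<forall>s\<in>simplices Y (Suc n). face Y (Suc n) i s \<in> simplices Y n) \<and>
     (\<forall>n. \<forall>i\<le>n. \<forall>s\<in>simplices Y n. degen Y n i s \<in> simplices Y (Suc n)) \<and>
     (\<forall>n. \<forall>j\<le>Suc (Suc n). \<forall>i<j. \<forall>s\<in>simplices Y (Suc (Suc n)).
        face Y (Suc n) i (face Y (Suc (Suc n)) j s)
          = face Y (Suc n) (j - 1) (face Y (Suc (Suc n)) i s)) \<and>
     (\<forall>n. \<forall>j\<le>n. \<forall>i<j. \<forall>s\<in>simplices Y n.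
        face Y (Suc n) i (degen Y n j s) = degen Y (n - 1) (j - 1) (face Y n i s)) \<and>
     (\<forall>n. \<forall>j\<le>n. \<forall>s\<in>simplices Y n.
        face Y (Suc n) j (degen Y n j s) = s \<and> face Y (Suc n) (Suc j) (degen Y n j s) = s) \<and>
     (\<forall>n. \<forall>j\<le>n. \<forall>i\<le>Suc n. Suc j < i \<longrightarrow> (\<forall>s\<in>simplices Y n.
        face Y (Suc n) i (degen Y n j s) = degen Y (n - 1) j (face Y n (i - 1) s))) \<and>
     (\<forall>n. \<forall>j\<le>n. \<forall>i\<le>j. \<forall>s\<in>simplices Y n.
        degen Y (Suc n) i (degen Y n j s) = degen Y (Suc n) (Suc j) (degen Y n i s))"

definition sub_sset :: "'s sset \<Rightarrow> 's sset \<Rightarrow> bool" where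
  "sub_sset Z Y \<longleftrightarrow>
     simplicial_set Z \<and> (\<forall>n. simplices Z n \<subseteq> simplices Y n) \<and>
     face Z = face Y \<and> degen Z = degen Y"

text \<open>The tuple \<open>(x\<^sub>0, \<dots>, x\<^sub>k)\<close> is encoded as a list of length \<open>k + 1\<close>.\<close>

definition E_sset :: "'x set \<Rightarrow> 'x list sset" where
  "E_sset X =
     \<lparr>simplices = (\<lambda>k. {xs. length xs = Suc k \<and> set xs \<subseteq> X}),
      face = (\<lambda>k i xs. take i xs @ drop (Suc i) xs),
      degen = (\<lambda>k i xs. take (Suc i) xs @ drop i xs)\<rparr>"

text \<open>\<open>S \<cdot> E C\<close> for a set \<open>S\<close> of group elements acting through \<open>act\<close> on the ambient set of \<open>C\<close>.\<close>

definition translates_E :: "('g \<Rightarrow> 'x \<Rightarrow> 'x) \<Rightarrow> 'g set \<Rightarrow> 'x set \<Rightarrow> 'x list sset" where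
  "translates_E act S C =
     (E_sset C)\<lparr>simplices := (\<lambda>k. \<Union>g\<in>S. map (act g) ` simplices (E_sset C) k)\<rparr>"

section \<open>Reduced simplicial homology with coefficients in a ring\<close>

definition sset_chains :: "('r, 'm) ring_scheme \<Rightarrow> 's sset \<Rightarrow> nat \<Rightarrow> ('s \<Rightarrow> 'r) set" where
  "sset_chains R Y k =
     {c. (\<forall>s. c s \<in> carrier R) \<and> (\<forall>s. s \<notin> simplices Y k \<longrightarrow> c s = \<zero>\<^bsub>R\<^esub>) \<and>
         finite {s. c s \<noteq> \<zero>\<^bsub>R\<^esub>}}"

definition sset_boundary ::
    "('r, 'm) ring_scheme \<Rightarrow> 's sset \<Rightarrow> nat \<Rightarrow> ('s \<Rightarrow> 'r) \<Rightarrow> ('s \<Rightarrow> 'r)" where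
  "sset_boundary R Y k c =
     (\<lambda>t. \<Oplus>\<^bsub>R\<^esub>s\<in>{s. c s \<noteq> \<zero>\<^bsub>R\<^esub>}. \<Oplus>\<^bsub>R\<^esub>i\<in>{i. i \<le> k \<and> face Y k i s = t}.
            if even i then c s else \<ominus>\<^bsub>R\<^esub> c s)"

definition sset_augmentation :: "('r, 'm) ring_scheme \<Rightarrow> ('s \<Rightarrow> 'r) \<Rightarrow> 'r" where
  "sset_augmentation R c = (\<Oplus>\<^bsub>R\<^esub>s\<in>{s. c s \<noteq> \<zero>\<^bsub>R\<^esub>}. c s)"

definition sset_reduced_cycles :: "('r, 'm) ring_scheme \<Rightarrow> 's sset \<Rightarrow> nat \<Rightarrow> ('s \<Rightarrow> 'r) set" where
  "sset_reduced_cycles R Y k =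
     {c \<in> sset_chains R Y k.
        if k = 0 then sset_augmentation R c = \<zero>\<^bsub>R\<^esub>
        else sset_boundary R Y k c = (\<lambda>t. \<zero>\<^bsub>R\<^esub>)}"

definition sset_boundaries :: "('r, 'm) ring_scheme \<Rightarrow> 's sset \<Rightarrow> nat \<Rightarrow> ('s \<Rightarrow> 'r) set" where
  "sset_boundaries R Y k = sset_boundary R Y (Suc k) ` sset_chains R Y (Suc k)"

definition sset_reduced_cycle_group ::
    "('r, 'm) ring_scheme \<Rightarrow> 's sset \<Rightarrow> nat \<Rightarrow> ('s \<Rightarrow> 'r) monoid" where
  "sset_reduced_cycle_group R Y k =
     \<lparr>carrier = sset_reduced_cycles R Y k,
      mult = (\<lambda>c d s. c s \<oplus>\<^bsub>R\<^esub> d s),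
      one = (\<lambda>s. \<zero>\<^bsub>R\<^esub>)\<rparr>"

text \<open>Only the additive group underlying the \<open>R\<close>-module is recorded: it determines
  whether a homomorphism vanishes.\<close>

definition sset_reduced_homology ::
    "('r, 'm) ring_scheme \<Rightarrow> 's sset \<Rightarrow> nat \<Rightarrow> ('s \<Rightarrow> 'r) set monoid" where
  "sset_reduced_homology R Y k = sset_reduced_cycle_group R Y k Mod sset_boundaries R Y k"

text \<open>Chains of a simplicial subset are literally chains of the larger simplicial set (extended
  by zero), so the class \<open>z + B\<^sub>k(Y)\<close> is sent to \<open>z + B\<^sub>k(Z)\<close>; this is the union below,
  whose members do not depend on the chosen representative.\<close>

definition sset_inclusion_induced ::
    "('r, 'm) ring_scheme \<Rightarrow> 's sset \<Rightarrow> 's sset \<Rightarrow> nat \<Rightarrow> ('s \<Rightarrow> 'r) set \<Rightarrow> ('s \<Rightarrow> 'r) set" where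
  "sset_inclusion_induced R Y Z k \<xi> =
     (\<Union>z\<in>\<xi>. sset_boundaries R Z k #>\<^bsub>sset_reduced_cycle_group R Z k\<^esub> z)"

section \<open>Filtrations and essential acyclicity\<close>

definition directed_poset :: "'i set \<Rightarrow> ('i \<Rightarrow> 'i \<Rightarrow> bool) \<Rightarrow> bool" where
  "directed_poset A leq \<longleftrightarrow>
     A \<noteq> {} \<and> (\<forall>a\<in>A. leq a a) \<and>
     (\<forall>a\<in>A. \<forall>b\<in>A. leq a b \<and> leq b a \<longrightarrow> a = b) \<and>
     (\<forall>a\<in>A. \<forall>b\<in>A. \<forall>c\<in>A. leq a b \<and> leq b c \<longrightarrow> leq a c) \<and>
     (\<forall>a\<in>A. \<forall>b\<in>A. \<exists>c\<in>A. leq a c \<and> leq b c)"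

definition sset_filtration ::
    "'s sset \<Rightarrow> 'i set \<Rightarrow> ('i \<Rightarrow> 'i \<Rightarrow> bool) \<Rightarrow> ('i \<Rightarrow> 's sset) \<Rightarrow> bool" where
  "sset_filtration Y A leq F \<longleftrightarrow>
     simplicial_set Y \<and> directed_poset A leq \<and>
     (\<forall>a\<in>A. sub_sset (F a) Y) \<and>
     (\<forall>k. (\<Union>a\<in>A. simplices (F a) k) = simplices Y k) \<and>
     (\<forall>a\<in>A. \<forall>b\<in>A. leq a b \<longrightarrow> sub_sset (F a) (F b))"

definition essentially_acyclic ::
    "('r, 'm) ring_scheme \<Rightarrow> int \<Rightarrow> 'i set \<Rightarrow> ('i \<Rightarrow> 'i \<Rightarrow> bool) \<Rightarrow> ('i \<Rightarrow> 's sset) \<Rightarrow> bool" where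
  "essentially_acyclic R m A leq F \<longleftrightarrow>
     (\<forall>k::nat. int k \<le> m \<longrightarrow>
        (\<forall>a\<in>A. \<exists>b\<in>A. leq a b \<and>
           (\<forall>\<xi> \<in> carrier (sset_reduced_homology R (F a) k).
              sset_inclusion_induced R (F a) (F b) k \<xi>
                = \<one>\<^bsub>sset_reduced_homology R (F b) k\<^esub>)))"

definition compact_subsets :: "'x topology \<Rightarrow> 'x set set" where
  "compact_subsets T = {C. compactin T C}"

definition Sigma_top ::
    "('r, 'n) ring_scheme \<Rightarrow> nat \<Rightarrow> ('g, 'm) monoid_scheme \<Rightarrow> 'g topology \<Rightarrow> ('g \<Rightarrow> real) set" where
  "Sigma_top R k G T =
     {chi. character G T chi \<and>
         essentially_acyclic R (int k - 1) (compact_subsets T) (\<subseteq>)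
           (\<lambda>C. translates_E (\<lambda>g x. g \<otimes>\<^bsub>G\<^esub> x) (char_halfspace G chi) C)}"

definition type_CP ::
    "('r, 'n) ring_scheme \<Rightarrow> nat \<Rightarrow> ('g, 'm) monoid_scheme \<Rightarrow> 'g topology \<Rightarrow> bool" where
  "type_CP R n G T \<longleftrightarrow>
     essentially_acyclic R (int n - 1) (compact_subsets T) (\<subseteq>)
       (\<lambda>C. translates_E (\<lambda>g x. g \<otimes>\<^bsub>G\<^esub> x) (carrier G) C)"

text \<open>The families defining \<open>Sigma_top\<close> and their analogues on \<open>G/L\<close> are filtrations.\<close>

lemma simplicial_set_translates_E:
  fixes act :: "'g \<Rightarrow> 'x \<Rightarrow> 'x"
  shows "simplicial_set (translates_E act S C)"
proof -
  let ?Y = "translates_E act S C"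
  let ?f = "\<lambda>i xs. take i xs @ drop (Suc i) xs"
  let ?d = "\<lambda>i xs. take (Suc i) xs @ drop i xs"
  have face: "face ?Y n i = ?f i" and degen: "degen ?Y n i = ?d i" for n i
    by (simp_all add: translates_E_def E_sset_def)
  have mem: "s \<in> simplices ?Y n \<longleftrightarrow>
      (\<exists>g\<in>S. \<exists>xs. s = map (act g) xs \<and> length xs = Suc n \<and> set xs \<subseteq> C)" for s n
    by (auto simp: translates_E_def E_sset_def)
  have len: "length s = Suc n" if "s \<in> simplices ?Y n" for s n
    using that mem by auto
  have 1: "?f i s \<in> simplices ?Y n" if "i \<le> Suc n" and s: "s \<in> simplices ?Y (Suc n)" for n i s
  proof -
    obtain g xs where *: "g \<in> S" "s = map (act g) xs" "length xs = Suc (Suc n)" "set xs \<subseteq> C"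
      using s mem by auto
    have "?f i s = map (act g) (?f i xs)" "length (?f i xs) = Suc n" "set (?f i xs) \<subseteq> C"
      using * that by (auto simp: take_map drop_map dest: in_set_takeD in_set_dropD)
    then show ?thesis using mem *(1) by blast
  qed
  have 2: "?d i s \<in> simplices ?Y (Suc n)" if "i \<le> n" and s: "s \<in> simplices ?Y n" for n i s
  proof -
    obtain g xs where *: "g \<in> S" "s = map (act g) xs" "length xs = Suc n" "set xs \<subseteq> C"
      using s mem by auto
    have "?d i s = map (act g) (?d i xs)" "length (?d i xs) = Suc (Suc n)" "set (?d i xs) \<subseteq> C"
      using * that by (auto simp: take_map drop_map dest: in_set_takeD in_set_dropD)
    then show ?thesis using mem *(1) by blast
  qed
  define f where "f = (\<lambda>i (xs :: 'x list). take i xs @ drop (Suc i) xs)"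
  define d where "d = (\<lambda>i (xs :: 'x list). take (Suc i) xs @ drop i xs)"
  have nthf: "f i s ! l = (if l < i then s ! l else s ! Suc l)" if "i < length s" "Suc l < length s"
    for i l and s :: "'x list"
    using that by (auto simp: f_def d_def nth_append)
  have nthd: "d i s ! l = (if l \<le> i then s ! l else s ! (l - 1))" if "i < length s" "l \<le> length s"
    for i l and s :: "'x list"
    using that by (auto simp: f_def d_def nth_append min_def intro!: arg_cong[of _ _ "nth s"])
  have lenf: "length (f i s) = length s - 1" and lend: "length (d i s) = Suc (length s)"
    if "i < length s" for i and s :: "'x list"
    using that by (auto simp: f_def d_def)
  note N = nthf nthd lenf lend
  have 3: "f i (f j s) = f (j - 1) (f i s)" if "length s = Suc (Suc (Suc n))" "j \<le> Suc (Suc n)" "i < j"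
    for i j n and s :: "'x list"
    by (rule nth_equalityI) (use that in \<open>auto simp: N\<close>)
  have 4: "f i (d j s) = d (j - 1) (f i s)" if "length s = Suc n" "j \<le> n" "i < j"
    for i j n and s :: "'x list"
    by (rule nth_equalityI) (use that in \<open>auto simp: N\<close>)
  have 5: "f j (d j s) = s" "f (Suc j) (d j s) = s" if "length s = Suc n" "j \<le> n"
    for j n and s :: "'x list"
    by (rule nth_equalityI; use that in \<open>auto simp: N\<close>)+
  have 6: "f i (d j s) = d j (f (i - 1) s)" if "length s = Suc n" "j \<le> n" "i \<le> Suc n" "Suc j < i"
    for i j n and s :: "'x list"
    by (rule nth_equalityI) (use that in \<open>auto simp: N\<close>)
  have 7: "d i (d j s) = d (Suc j) (d i s)" if "length s = Suc n" "j \<le> n" "i \<le> j"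
    for i j n and s :: "'x list"
    by (rule nth_equalityI) (use that in \<open>auto simp: N\<close>)
  have fd: "face ?Y n = f" "degen ?Y n = d" for n
    by (intro ext, simp add: face f_def)(intro ext, simp add: degen d_def)
  show ?thesis
    unfolding simplicial_set_def fd
  proof (intro conjI allI impI ballI)
    show "f i s \<in> simplices ?Y n" if "i \<le> Suc n" "s \<in> simplices ?Y (Suc n)" for n i s
      using 1[OF that] by (simp only: f_def)
    show "d i s \<in> simplices ?Y (Suc n)" if "i \<le> n" "s \<in> simplices ?Y n" for n i s
      using 2[OF that] by (simp only: d_def)
    fix n i j s
    show "f i (f j s) = f (j - 1) (f i s)"
      if "j \<le> Suc (Suc n)" "i < j" "s \<in> simplices ?Y (Suc (Suc n))"
      using 3[OF len[OF that(3)] that(1,2)] .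
    assume s: "s \<in> simplices ?Y n" and j: "j \<le> n"
    show "f j (d j s) = s" "f (Suc j) (d j s) = s"
      using 5[OF len[OF s] j] .
    show "f i (d j s) = d (j - 1) (f i s)" if "i < j"
      using 4[OF len[OF s] j that] .
    show "f i (d j s) = d j (f (i - 1) s)" if "i \<le> Suc n" "Suc j < i"
      using 6[OF len[OF s] j that] .
    show "d i (d j s) = d (Suc j) (d i s)" if "i \<le> j"
      using 7[OF len[OF s] j that] .
  qed
qed

lemma simplicial_set_E_sset: "simplicial_set (E_sset X)"
proof -
  have "translates_E (\<lambda>_ x. x) {()} X = E_sset X"
    by (simp add: translates_E_def E_sset_def)
  then show ?thesis by (metis simplicial_set_translates_E)
qed

lemma sset_filtration_translates_E:
  assumes X: "topspace X = M" and one: "e \<in> S" "\<And>x. x \<in> M \<Longrightarrow> act e x = x"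
    and act: "\<And>g x. g \<in> S \<Longrightarrow> x \<in> M \<Longrightarrow> act g x \<in> M"
  shows "sset_filtration (E_sset M) (compact_subsets X) (\<subseteq>) (translates_E act S)"
  unfolding sset_filtration_def
proof (intro conjI ballI allI impI simplicial_set_E_sset)
  show "directed_poset (compact_subsets X) (\<subseteq>)"
    unfolding directed_poset_def
  proof (intro conjI ballI impI)
    show "compact_subsets X \<noteq> {}"
      using compactin_empty by (auto simp: compact_subsets_def)
    show "\<exists>D\<in>compact_subsets X. A \<subseteq> D \<and> B \<subseteq> D"
      if "A \<in> compact_subsets X" "B \<in> compact_subsets X" for A B
      using that by (intro bexI[of _ "A \<union> B"]) (auto simp: compact_subsets_def compactin_Un)
  qed auto
  have sub: "C \<subseteq> M" if "C \<in> compact_subsets X" for C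
    using that X by (auto simp: compact_subsets_def compactin_def)
  show "sub_sset (translates_E act S C) (E_sset M)" if "C \<in> compact_subsets X" for C
    using sub[OF that] act simplicial_set_translates_E[of act S C]
    by (fastforce simp: sub_sset_def translates_E_def E_sset_def)
  show "sub_sset (translates_E act S C) (translates_E act S D)" if "C \<subseteq> D" for C D
    using that simplicial_set_translates_E[of act S C]
    by (fastforce simp: sub_sset_def translates_E_def E_sset_def)
  show "(\<Union>C\<in>compact_subsets X. simplices (translates_E act S C) k) = simplices (E_sset M) k"
    (is "?L = ?R") for k
  proof
    show "?L \<subseteq> ?R"
      using sub act by (fastforce simp: translates_E_def E_sset_def)
    show "?R \<subseteq> ?L"
    proof
      fix xs assume "xs \<in> ?R"
      then have xs: "length xs = Suc k" "set xs \<subseteq> M" by (auto simp: E_sset_def)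
      then have "set xs \<in> compact_subsets X"
        using X by (auto simp: compact_subsets_def intro: finite_imp_compactin)
      moreover have "map (act e) xs = xs"
        using xs one(2) by (auto intro!: map_idI)
      then have "xs \<in> simplices (translates_E act S (set xs)) k"
        using xs one(1) by (force simp: translates_E_def E_sset_def)
      ultimately show "xs \<in> ?L" by blast
    qed
  qed
qed

lemma one_in_char_halfspace: "group G \<Longrightarrow> character G T chi \<Longrightarrow> \<one>\<^bsub>G\<^esub> \<in> char_halfspace G chi"
proof -
  assume G: "group G" and chi: "character G T chi"
  interpret group G by fact
  have "chi (\<one>\<^bsub>G\<^esub> \<otimes>\<^bsub>G\<^esub> \<one>\<^bsub>G\<^esub>) = chi \<one>\<^bsub>G\<^esub> + chi \<one>\<^bsub>G\<^esub>"
    using chi unfolding character_def hom_def real_add_group_def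
    by (metis (mono_tags, lifting) mem_Collect_eq monoid.select_convs(1) one_closed)
  then show ?thesis by (simp add: char_halfspace_def)
qed

lemma sset_filtration_group:
  assumes "topological_group G T" and "character G T chi"
  shows "sset_filtration (E_sset (carrier G)) (compact_subsets T) (\<subseteq>)
           (translates_E (\<lambda>g x. g \<otimes>\<^bsub>G\<^esub> x) (char_halfspace G chi))"
proof -
  interpret group G using assms(1) by (simp add: topological_group_def)
  show ?thesis
    using assms one_in_char_halfspace[OF is_group assms(2)]
    by (intro sset_filtration_translates_E) (auto simp: topological_group_def char_halfspace_def)
qed

lemma sset_filtration_left_cosets:
  assumes "topological_group G T" and "character G T chi" and "subgroup L G"
  shows "sset_filtration (E_sset (lcosets\<^bsub>G\<^esub> L)) (compact_subsets (left_coset_topology G T L)) (\<subseteq>)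
           (translates_E (\<lambda>g x. g <#\<^bsub>G\<^esub> x) (char_halfspace G chi))"
proof -
  interpret group G using assms(1) by (simp add: topological_group_def)
  have L: "L \<subseteq> carrier G" using assms(3) by (rule subgroup.subset)
  show ?thesis
  proof (rule sset_filtration_translates_E)
    show "topspace (left_coset_topology G T L) = lcosets\<^bsub>G\<^esub> L"
      using assms(1) by (simp add: topological_group_def topspace_left_coset_topology)
    show "\<one>\<^bsub>G\<^esub> \<in> char_halfspace G chi" using assms one_in_char_halfspace is_group by blast
    show "\<one>\<^bsub>G\<^esub> <#\<^bsub>G\<^esub> x = x" if "x \<in> lcosets\<^bsub>G\<^esub> L" for x
      using that lcos_mult_one lcosets_subset_PowG[OF assms(3)] by blast
    show "g <#\<^bsub>G\<^esub> x \<in> lcosets\<^bsub>G\<^esub> L" if "g \<in> char_halfspace G chi" "x \<in> lcosets\<^bsub>G\<^esub> L" for g x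
      using that L by (auto simp: LCOSETS_def char_halfspace_def lcos_m_assoc)
  qed
qed

end

(* Let P be the half-space monoid of the character. For a compact subset C of the group, the preimage in
   E(Gamma) of P.E(C Lambda / Lambda) is P.E(C Lambda), and choosing coset representatives shows that the
   two have the same homology. It remains to compare P.E(C) with P.E(C Lambda). Since Lambda almost
   commutes with compacts, all vertices of a simplex of g.E(C Lambda) lie in g Lambda D for some larger
   compact D. The sets g Lambda.E(D) are translates of Lambda.E(D), which is essentially (n-1)-acyclic
   because Lambda is of type CP_n, while g.E(D Lambda) is a full simplex, hence acyclic. So the method of
   acyclic carriers deforms chains of P.E(C Lambda) of dimension at most n, relative to P.E(C) and inside
   P.E(D Lambda), into P.E(D): every relative cycle of dimension at most n is homologous to a chain of
   P.E(D). Both implications follow. *)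

theory Submission
  imports Defs
begin

section \<open>Chains with coefficients in a ring\<close>

text \<open>The obstacle is that a simplex of P.E(C Lambda) can be written as a translate by many
  different g, while its deformation has to be one chain. Two such elements g, g' are linked by a
  common vertex, so g' = g c l c'^-1 with c, c' in C and l in Lambda. Almost commutation then turns
  the carriers for g' into carriers for g after one enlargement of the compact set, uniformly in g
  and g'. Hence arbitrary choices suffice and no equivariance is imposed.

  The two ranges of k also come from the carriers. Extending the deformation from dimension m to m +
  1 fills m-cycles of g Lambda.E(D), which is possible for m < n, so chains of dimension at most n
  can be moved. Implication (2) moves a j-cycle itself and works for j <= n; implication (1) moves a
  (j + 1)-chain bounding a j-cycle and works for j < n. Since Sigma^k tests the degrees j < k, this
  gives k <= n + 1 and k <= n.\<close>

locale cring_chains = cring R for R (structure)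
begin

definition chains :: "'s set \<Rightarrow> ('s \<Rightarrow> 'a) set" where
  "chains X = {c. (\<forall>s. c s \<in> carrier R) \<and> (\<forall>s. s \<notin> X \<longrightarrow> c s = \<zero>) \<and> finite {s. c s \<noteq> \<zero>}}"

definition zero_chain :: "'s \<Rightarrow> 'a" where
  "zero_chain = (\<lambda>_. \<zero>)"

definition add_chain :: "('s \<Rightarrow> 'a) \<Rightarrow> ('s \<Rightarrow> 'a) \<Rightarrow> 's \<Rightarrow> 'a" (infixl "\<oplus>\<^sub>c" 65) where
  "c \<oplus>\<^sub>c d = (\<lambda>s. c s \<oplus> d s)"

definition diff_chain :: "('s \<Rightarrow> 'a) \<Rightarrow> ('s \<Rightarrow> 'a) \<Rightarrow> 's \<Rightarrow> 'a" (infixl "\<ominus>\<^sub>c" 65) where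
  "c \<ominus>\<^sub>c d = (\<lambda>s. c s \<ominus> d s)"

definition scale_chain :: "'a \<Rightarrow> ('s \<Rightarrow> 'a) \<Rightarrow> 's \<Rightarrow> 'a" where
  "scale_chain a c = (\<lambda>s. a \<otimes> c s)"

definition basis :: "'s \<Rightarrow> 's \<Rightarrow> 'a" where
  "basis s = (\<lambda>t. if t = s then \<one> else \<zero>)"

text \<open>The linear extension of a map given on simplices. Boundary, induced maps and homotopies
  all have this form, so an identity between them need only be checked on single simplices. In the
  rules below \<open>f s\<close> is a chain for every \<open>s\<close>, which keeps domain
  conditions out of the algebra.\<close>

definition lift :: "('s \<Rightarrow> 't \<Rightarrow> 'a) \<Rightarrow> ('s \<Rightarrow> 'a) \<Rightarrow> 't \<Rightarrow> 'a" where
  "lift f c = (\<lambda>t. \<Oplus>s\<in>{s. c s \<noteq> \<zero>}. c s \<otimes> f s t)"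

definition push :: "('s \<Rightarrow> 't) \<Rightarrow> ('s \<Rightarrow> 'a) \<Rightarrow> 't \<Rightarrow> 'a" where
  "push j = lift (\<lambda>s. basis (j s))"

lemma chains_carrier: "c \<in> chains X \<Longrightarrow> c s \<in> carrier R"
  by (simp add: chains_def)

lemma chains_finite: "c \<in> chains X \<Longrightarrow> finite {s. c s \<noteq> \<zero>}"
  by (simp add: chains_def)

lemma chains_outside: "c \<in> chains X \<Longrightarrow> s \<notin> X \<Longrightarrow> c s = \<zero>"
  by (simp add: chains_def)

lemma chains_mono: "c \<in> chains X \<Longrightarrow> X \<subseteq> Y \<Longrightarrow> c \<in> chains Y"
  by (auto simp: chains_def)

lemma chains_UNIV: "c \<in> chains X \<Longrightarrow> c \<in> chains UNIV"
  by (auto simp: chains_def)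

lemma zero_chain_closed [simp]: "zero_chain \<in> chains X"
  by (simp add: chains_def zero_chain_def)

lemma basis_closed [simp]: "s \<in> X \<Longrightarrow> basis s \<in> chains X"
  by (auto simp: chains_def basis_def intro: finite_subset[of _ "{s}"])

lemma add_chain_closed [simp]: "c \<in> chains X \<Longrightarrow> d \<in> chains X \<Longrightarrow> c \<oplus>\<^sub>c d \<in> chains X"
  by (auto simp: chains_def add_chain_def
      intro: finite_subset[of _ "{s. c s \<noteq> \<zero>} \<union> {s. d s \<noteq> \<zero>}"])

lemma diff_chain_closed [simp]: "c \<in> chains X \<Longrightarrow> d \<in> chains X \<Longrightarrow> c \<ominus>\<^sub>c d \<in> chains X"
  by (auto simp: chains_def diff_chain_def minus_eq
      intro: finite_subset[of _ "{s. c s \<noteq> \<zero>} \<union> {s. d s \<noteq> \<zero>}"])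

lemma scale_chain_closed [simp]: "a \<in> carrier R \<Longrightarrow> c \<in> chains X \<Longrightarrow> scale_chain a c \<in> chains X"
  by (auto simp: chains_def scale_chain_def intro: finite_subset[of _ "{s. c s \<noteq> \<zero>}"])

text \<open>Induction on the support: clearing one coefficient splits off a multiple of a basis
  element and leaves a chain on the same \<open>X\<close>.\<close>

lemma chains_induct [consumes 1, case_names zero step]:
  assumes "c \<in> chains X"
    and "P zero_chain"
    and "\<And>c a s. c \<in> chains X \<Longrightarrow> a \<in> carrier R \<Longrightarrow> s \<in> X \<Longrightarrow> P c \<Longrightarrow>
      P (c \<oplus>\<^sub>c scale_chain a (basis s))"
  shows "P c"
proof -
  have "P c" if "finite A" "c \<in> chains X" "{s. c s \<noteq> \<zero>} = A" for A c
    using that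
  proof (induction A arbitrary: c rule: finite_induct)
    case empty
    then have "c = zero_chain" by (auto simp: zero_chain_def)
    then show ?case using assms(2) by simp
  next
    case (insert x A)
    let ?d = "c(x := \<zero>)"
    have c: "\<And>s. c s \<in> carrier R" using insert.prems by (simp add: chains_def)
    have A: "{s. ?d s \<noteq> \<zero>} = A" using insert by auto
    have d: "?d \<in> chains X"
      using insert.prems insert.hyps A by (auto simp: chains_def)
    have x: "x \<in> X" using insert.prems chains_outside[of c X x] by blast
    have "c = ?d \<oplus>\<^sub>c scale_chain (c x) (basis x)"
      using c by (auto simp: add_chain_def scale_chain_def basis_def)
    then show ?case
      using assms(3)[OF d c[of x] x] insert.IH[OF d A] by simp
  qed
  then show ?thesis using assms(1) chains_finite by blast
qed

text \<open>Cancellation can make the support of a sum smaller than the union of the supports; the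
  freedom to sum over a larger finite set is what yields additivity.\<close>

lemma lift_eq:
  assumes "finite A" "{s. c s \<noteq> \<zero>} \<subseteq> A" "c \<in> chains UNIV" "\<And>s. f s \<in> chains UNIV"
  shows "lift f c t = (\<Oplus>s\<in>A. c s \<otimes> f s t)"
  unfolding lift_def
  using assms chains_carrier[OF assms(3)] chains_carrier[OF assms(4)]
  by (intro add.finprod_mono_neutral_cong_left) auto

text \<open>This is how carriers are tracked: the operator is total, but only its values on
  \<open>X\<close> decide where the image lies.\<close>

lemma lift_closed:
  assumes "c \<in> chains X" "\<And>s. f s \<in> chains UNIV" "\<And>s. s \<in> X \<Longrightarrow> f s \<in> chains Y"
  shows "lift f c \<in> chains Y"
proof -
  note C = chains_carrier[OF assms(1)] chains_carrier[OF assms(2)]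
  have supp: "s \<in> X" if "c s \<noteq> \<zero>" for s using that assms(1) by (auto simp: chains_def)
  have zero: "lift f c t = \<zero>" if "\<And>s. c s \<noteq> \<zero> \<Longrightarrow> f s t = \<zero>" for t
    unfolding lift_def using C that by (intro add.finprod_one_eqI) auto
  have "{t. lift f c t \<noteq> \<zero>} \<subseteq> (\<Union>s\<in>{s. c s \<noteq> \<zero>}. {t. f s t \<noteq> \<zero>})"
    using zero by blast
  moreover have "finite (\<Union>s\<in>{s. c s \<noteq> \<zero>}. {t. f s t \<noteq> \<zero>})"
    using assms by (auto simp: chains_def)
  ultimately have "finite {t. lift f c t \<noteq> \<zero>}" by (rule finite_subset)
  moreover have "lift f c t = \<zero>" if "t \<notin> Y" for t
    using that zero supp chains_outside[OF assms(3)] by blast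
  moreover have "lift f c t \<in> carrier R" for t
    unfolding lift_def using C by (intro finsum_closed) auto
  ultimately show ?thesis by (auto simp: chains_def)
qed

section \<open>Linearity and composition of linear extensions\<close>

lemma lift_zero [simp]: "lift f zero_chain = zero_chain"
  by (auto simp: lift_def zero_chain_def)

lemma lift_add:
  assumes "c \<in> chains UNIV" "d \<in> chains UNIV" "\<And>s. f s \<in> chains UNIV"
  shows "lift f (c \<oplus>\<^sub>c d) = lift f c \<oplus>\<^sub>c lift f d"
proof
  fix t
  let ?A = "{s. c s \<noteq> \<zero>} \<union> {s. d s \<noteq> \<zero>}"
  have A: "finite ?A" using assms by (simp add: chains_def)
  note C = chains_carrier[OF assms(1)] chains_carrier[OF assms(2)] chains_carrier[OF assms(3)]
  have "lift f (c \<oplus>\<^sub>c d) t = (\<Oplus>s\<in>?A. (c \<oplus>\<^sub>c d) s \<otimes> f s t)"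
    by (rule lift_eq[OF A _ add_chain_closed[OF assms(1,2)] assms(3)]) (auto simp: add_chain_def)
  also have "\<dots> = (\<Oplus>s\<in>?A. c s \<otimes> f s t \<oplus> d s \<otimes> f s t)"
    using C by (intro finsum_cong) (auto simp: add_chain_def l_distr simp_implies_def)
  also have "\<dots> = (\<Oplus>s\<in>?A. c s \<otimes> f s t) \<oplus> (\<Oplus>s\<in>?A. d s \<otimes> f s t)"
    using C by (intro finsum_addf) auto
  also have "\<dots> = (lift f c \<oplus>\<^sub>c lift f d) t"
    using lift_eq[OF A _ assms(1,3)] lift_eq[OF A _ assms(2,3)] by (simp add: add_chain_def)
  finally show "lift f (c \<oplus>\<^sub>c d) t = (lift f c \<oplus>\<^sub>c lift f d) t" .
qed

lemma lift_scale:
  assumes "a \<in> carrier R" "c \<in> chains UNIV" "\<And>s. f s \<in> chains UNIV"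
  shows "lift f (scale_chain a c) = scale_chain a (lift f c)"
proof
  fix t
  note C = chains_carrier[OF assms(2)] chains_carrier[OF assms(3)]
  have A: "finite {s. c s \<noteq> \<zero>}" using assms by (simp add: chains_def)
  have "lift f (scale_chain a c) t = (\<Oplus>s\<in>{s. c s \<noteq> \<zero>}. scale_chain a c s \<otimes> f s t)"
    using assms(1) by (intro lift_eq[OF A _ scale_chain_closed[OF assms(1,2)] assms(3)])
      (auto simp: scale_chain_def)
  also have "\<dots> = (\<Oplus>s\<in>{s. c s \<noteq> \<zero>}. a \<otimes> (c s \<otimes> f s t))"
    using C assms(1) by (intro finsum_cong) (auto simp: scale_chain_def m_assoc simp_implies_def)
  also have "\<dots> = scale_chain a (lift f c) t"
    unfolding scale_chain_def lift_def using C assms(1) A by (intro finsum_rdistr[symmetric]) auto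
  finally show "lift f (scale_chain a c) t = scale_chain a (lift f c) t" .
qed

lemma lift_basis [simp]:
  assumes "\<And>s. f s \<in> chains UNIV"
  shows "lift f (basis s) = f s"
proof
  fix t
  have "lift f (basis s) t = (\<Oplus>s'\<in>{s}. basis s s' \<otimes> f s' t)"
    by (rule lift_eq[OF _ _ basis_closed[of s UNIV] assms]) (auto simp: basis_def)
  then show "lift f (basis s) t = f s t"
    using chains_carrier[OF assms] by (simp add: basis_def)
qed

lemma diff_chain_self [simp]: "c \<in> chains UNIV \<Longrightarrow> c \<ominus>\<^sub>c c = zero_chain"
  by (auto simp: diff_chain_def zero_chain_def chains_carrier minus_eq r_neg)

lemma diff_chain_zero [simp]: "c \<in> chains UNIV \<Longrightarrow> c \<ominus>\<^sub>c zero_chain = c"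
  by (auto simp: diff_chain_def zero_chain_def chains_carrier minus_eq)

lemma diff_chain_eq:
  "c \<in> chains UNIV \<Longrightarrow> d \<in> chains UNIV \<Longrightarrow> c \<ominus>\<^sub>c d = c \<oplus>\<^sub>c scale_chain (\<ominus> \<one>) d"
  by (auto simp: diff_chain_def add_chain_def scale_chain_def minus_eq l_minus chains_carrier)

lemma lift_diff:
  assumes "c \<in> chains UNIV" "d \<in> chains UNIV" "\<And>s. f s \<in> chains UNIV"
  shows "lift f (c \<ominus>\<^sub>c d) = lift f c \<ominus>\<^sub>c lift f d"
proof -
  have "lift f c \<in> chains UNIV" "lift f d \<in> chains UNIV"
    using assms lift_closed by blast+
  then show ?thesis
    using assms by (simp add: diff_chain_eq lift_add lift_scale)
qed

lemma lift_cong: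
  assumes "c \<in> chains X" "\<And>s. s \<in> X \<Longrightarrow> f s = g s"
    "\<And>s. f s \<in> chains UNIV" "\<And>s. g s \<in> chains UNIV"
  shows "lift f c = lift g c"
  unfolding lift_def using assms(2) chains_outside[OF assms(1)] chains_carrier[OF assms(1)] chains_carrier[OF assms(4)]
  by (intro ext finsum_cong') (auto intro!: m_closed, metis)

text \<open>Associativity of linear extension, checked one simplex at a time. The rules for the
  boundary of an extended map rest on it.\<close>

lemma lift_lift:
  assumes "c \<in> chains UNIV" "\<And>s. f s \<in> chains UNIV" "\<And>s. g s \<in> chains UNIV"
  shows "lift g (lift f c) = lift (\<lambda>s. lift g (f s)) c"
  using assms(1)
proof (induction rule: chains_induct)
  case (step c a s)
  have gf: "\<And>s. lift g (f s) \<in> chains UNIV" using assms lift_closed by blast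
  have fc: "lift f c \<in> chains UNIV" using step assms lift_closed by blast
  show ?case
    using step assms gf fc
    by (simp add: lift_add lift_scale lift_add lift_scale)
qed simp

lemma lift_fun_diff:
  assumes "c \<in> chains UNIV" "\<And>s. f s \<in> chains UNIV" "\<And>s. g s \<in> chains UNIV"
  shows "lift (\<lambda>s. f s \<ominus>\<^sub>c g s) c = lift f c \<ominus>\<^sub>c lift g c"
  using assms(1)
proof (induction rule: chains_induct)
  case zero
  then show ?case by simp
next
  case (step c a s)
  have *: "\<And>s. f s \<ominus>\<^sub>c g s \<in> chains UNIV" using assms by simp
  have "lift f c \<in> chains UNIV" "lift g c \<in> chains UNIV" using step assms lift_closed by blast+
  note C = chains_carrier[OF this(1)] chains_carrier[OF this(2)]
    chains_carrier[OF assms(2)] chains_carrier[OF assms(3)]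
  have "lift f c \<ominus>\<^sub>c lift g c \<oplus>\<^sub>c scale_chain a (f s \<ominus>\<^sub>c g s) =
     (lift f c \<oplus>\<^sub>c scale_chain a (f s)) \<ominus>\<^sub>c (lift g c \<oplus>\<^sub>c scale_chain a (g s))"
    unfolding add_chain_def diff_chain_def scale_chain_def
    using C step(2) by (intro ext) algebra
  then show ?case
    using step assms * by (simp add: lift_add lift_scale)
qed

lemma lift_basis_id [simp]:
  assumes "c \<in> chains UNIV"
  shows "lift basis c = c"
  using assms
  by (induction rule: chains_induct) (simp_all add: lift_add lift_scale)

lemma lift_zero_fun [simp]: "c \<in> chains UNIV \<Longrightarrow> lift (\<lambda>_. zero_chain) c = zero_chain"
  unfolding lift_def zero_chain_def by (intro ext add.finprod_one_eqI) (simp add: chains_carrier)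

section \<open>Maps of chains induced by maps of simplices\<close>

lemma push_closed: "c \<in> chains X \<Longrightarrow> (\<And>s. s \<in> X \<Longrightarrow> j s \<in> Y) \<Longrightarrow> push j c \<in> chains Y"
  unfolding push_def by (rule lift_closed[of _ X]) auto

lemma push_closed_UNIV [simp]: "c \<in> chains UNIV \<Longrightarrow> push j c \<in> chains UNIV"
  by (rule push_closed) auto

lemma push_push: "c \<in> chains UNIV \<Longrightarrow> push k (push j c) = push (\<lambda>s. k (j s)) c"
  unfolding push_def by (simp add: lift_lift)

lemma push_basis [simp]: "push j (basis s) = basis (j s)"
  by (simp add: push_def)

lemma push_diff:
  "c \<in> chains UNIV \<Longrightarrow> d \<in> chains UNIV \<Longrightarrow> push j (c \<ominus>\<^sub>c d) = push j c \<ominus>\<^sub>c push j d"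
  by (simp add: push_def lift_diff)

lemma push_zero [simp]: "push j zero_chain = zero_chain"
  by (simp add: push_def)

lemma push_id: "c \<in> chains X \<Longrightarrow> (\<And>s. s \<in> X \<Longrightarrow> j s = s) \<Longrightarrow> push j c = c"
  using lift_cong[of c X "\<lambda>s. basis (j s)" basis] by (simp add: push_def chains_UNIV)

section \<open>The augmented complex of tuples\<close>

text \<open>A \<open>k\<close>-simplex is a list of length \<open>k + 1\<close>, so the empty list spans the augmentation
  degree \<open>-1\<close> and the augmentation is the boundary map in degree \<open>0\<close>.\<close>

fun bd :: "'x list \<Rightarrow> 'x list \<Rightarrow> 'a" where
  "bd [] = zero_chain"
| "bd (x # xs) = basis xs \<ominus>\<^sub>c push (Cons x) (bd xs)"

definition boundary :: "('x list \<Rightarrow> 'a) \<Rightarrow> 'x list \<Rightarrow> 'a" where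
  "boundary = lift bd"

lemma bd_closed_UNIV [simp]: "bd xs \<in> chains UNIV"
  by (induction xs) auto

lemma bd_closed: "bd xs \<in> chains {ys. set ys \<subseteq> set xs \<and> Suc (length ys) = length xs}"
proof (induction xs)
  case (Cons x xs)
  have "push (Cons x) (bd xs) \<in> chains {ys. set ys \<subseteq> set (x # xs) \<and> Suc (length ys) = length (x # xs)}"
    by (rule push_closed[OF Cons]) auto
  then show ?case by (auto intro!: diff_chain_closed basis_closed)
qed simp

lemma boundary_closed_UNIV [simp]: "c \<in> chains UNIV \<Longrightarrow> boundary c \<in> chains UNIV"
  by (simp add: boundary_def lift_closed)

lemma boundary_basis [simp]: "boundary (basis xs) = bd xs"
  by (simp add: boundary_def)

lemma boundary_zero [simp]: "boundary zero_chain = zero_chain"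
  by (simp add: boundary_def)

lemma boundary_add: "c \<in> chains UNIV \<Longrightarrow> d \<in> chains UNIV \<Longrightarrow> boundary (c \<oplus>\<^sub>c d) = boundary c \<oplus>\<^sub>c boundary d"
  by (simp add: boundary_def lift_add)

lemma boundary_diff: "c \<in> chains UNIV \<Longrightarrow> d \<in> chains UNIV \<Longrightarrow> boundary (c \<ominus>\<^sub>c d) = boundary c \<ominus>\<^sub>c boundary d"
  by (simp add: boundary_def lift_diff)

lemma boundary_lift:
  "c \<in> chains UNIV \<Longrightarrow> (\<And>s. f s \<in> chains UNIV) \<Longrightarrow> boundary (lift f c) = lift (\<lambda>s. boundary (f s)) c"
  by (simp add: boundary_def lift_lift)

text \<open>The recursion for \<open>bd\<close> is the cone formula on one simplex, and this is its
  linear extension. For a cycle of the augmented complex the last term vanishes, so the cone with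
  any apex is a filling; this is why E of a nonempty set is acyclic.\<close>

lemma boundary_cone:
  assumes "c \<in> chains UNIV"
  shows "boundary (push (Cons x) c) = c \<ominus>\<^sub>c push (Cons x) (boundary c)"
proof -
  have "boundary (push (Cons x) c) = lift (\<lambda>s. basis s \<ominus>\<^sub>c push (Cons x) (bd s)) c"
    by (simp add: boundary_lift[OF assms] push_def)
  also have "\<dots> = c \<ominus>\<^sub>c lift (\<lambda>s. push (Cons x) (bd s)) c"
    using assms by (simp add: lift_fun_diff)
  also have "lift (\<lambda>s. push (Cons x) (bd s)) c = push (Cons x) (boundary c)"
    using assms by (simp add: push_def boundary_def lift_lift)
  finally show ?thesis .
qed

lemma boundary_bd [simp]: "boundary (bd xs) = zero_chain"
proof (induction xs)
  case (Cons x xs)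
  have "boundary (bd (x # xs)) = bd xs \<ominus>\<^sub>c boundary (push (Cons x) (bd xs))"
    by (simp add: boundary_diff)
  also have "boundary (push (Cons x) (bd xs)) = bd xs"
    using Cons by (simp add: boundary_cone)
  finally show ?case by simp
qed simp

lemma boundary_boundary:
  assumes "c \<in> chains UNIV"
  shows "boundary (boundary c) = zero_chain"
proof -
  have "boundary (lift bd c) = lift (\<lambda>s. boundary (bd s)) c"
    by (rule boundary_lift[OF assms]) simp
  then show ?thesis using assms by (simp add: boundary_def[symmetric])
qed

lemma push_map_bd: "push (map f) (bd xs) = bd (map f xs)"
proof (induction xs)
  case (Cons x xs)
  have "push (map f) (push (Cons x) (bd xs)) = push (Cons (f x)) (push (map f) (bd xs))"
    by (simp add: push_push)
  then show ?case using Cons by (simp add: push_diff)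
qed simp

lemma boundary_push_map:
  assumes "c \<in> chains UNIV"
  shows "boundary (push (map f) c) = push (map f) (boundary c)"
proof -
  have "boundary (push (map f) c) = lift (\<lambda>s. push (map f) (bd s)) c"
    by (simp add: boundary_lift[OF assms] push_def push_map_bd[unfolded push_def])
  then show ?thesis by (simp add: push_def boundary_def lift_lift[OF assms])
qed

text \<open>The chain homotopy from the simplicial map \<open>f\<close> to the simplicial map \<open>g\<close> given by the
  prisms \<open>(f x\<^sub>0, \<dots>, f x\<^sub>i, g x\<^sub>i, \<dots>, g x\<^sub>k)\<close>.\<close>

fun prism :: "('x \<Rightarrow> 'y) \<Rightarrow> ('x \<Rightarrow> 'y) \<Rightarrow> 'x list \<Rightarrow> 'y list \<Rightarrow> 'a" where
  "prism f g [] = zero_chain"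
| "prism f g (x # xs) = basis (f x # g x # map g xs) \<ominus>\<^sub>c push (Cons (f x)) (prism f g xs)"

lemma prism_closed_UNIV [simp]: "prism f g xs \<in> chains UNIV"
  by (induction xs) auto

lemma prism_closed:
  "prism f g xs \<in> chains {ys. set ys \<subseteq> f ` set xs \<union> g ` set xs \<and> length ys = Suc (length xs)}"
proof (induction xs)
  case (Cons x xs)
  have "push (Cons (f x)) (prism f g xs) \<in>
    chains {ys. set ys \<subseteq> f ` set (x # xs) \<union> g ` set (x # xs) \<and> length ys = Suc (length (x # xs))}"
    by (rule push_closed[OF Cons]) auto
  then show ?case by (auto intro!: diff_chain_closed basis_closed)
qed simp

text \<open>The leading prism \<open>f x # g x # map g xs\<close> is expanded by its first two
  vertices; the remaining ones form a cone with apex \<open>f x\<close> over the prisms of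
  \<open>xs\<close>. The face \<open>f x # map g xs\<close> occurs in both with opposite
  signs.\<close>

lemma boundary_prism:
  "boundary (prism f g xs) = basis (map g xs) \<ominus>\<^sub>c basis (map f xs) \<ominus>\<^sub>c lift (prism f g) (bd xs)"
proof (induction xs)
  case Nil
  then show ?case by simp
next
  case (Cons x xs)
  let ?H = "lift (prism f g)" and ?F = "push (Cons (f x))" and ?G = "push (Cons (g x))"
  let ?b = "push (map g) (bd xs)" and ?h = "prism f g xs"
  have b: "?b \<in> chains UNIV" by simp
  have Hbd: "?H (bd xs) \<in> chains UNIV" by (rule lift_closed[of _ UNIV]) auto
  have FH: "lift (\<lambda>s. ?F (prism f g s)) (bd xs) = ?F (?H (bd xs))"
    by (simp add: push_def lift_lift)
  have "?H (push (Cons x) (bd xs)) =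
      lift (\<lambda>s. basis (f x # g x # map g s) \<ominus>\<^sub>c ?F (prism f g s)) (bd xs)"
    by (simp add: push_def lift_lift)
  also have "\<dots> = ?F (?G ?b) \<ominus>\<^sub>c ?F (?H (bd xs))"
    by (simp add: lift_fun_diff FH push_push push_def[of "\<lambda>s. f x # g x # map g s"])
  finally have H: "?H (bd (x # xs)) = ?h \<ominus>\<^sub>c (?F (?G ?b) \<ominus>\<^sub>c ?F (?H (bd xs)))"
    by (simp add: lift_diff)
  have "boundary (prism f g (x # xs)) = bd (f x # g x # map g xs) \<ominus>\<^sub>c (?h \<ominus>\<^sub>c ?F (boundary ?h))"
    by (simp add: boundary_diff boundary_cone del: bd.simps)
  also have "?F (boundary ?h) =
      basis (f x # map g xs) \<ominus>\<^sub>c basis (f x # map f xs) \<ominus>\<^sub>c ?F (?H (bd xs))"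
    using Hbd by (simp add: Cons push_diff)
  also have "bd (f x # g x # map g xs) =
      basis (g x # map g xs) \<ominus>\<^sub>c (basis (f x # map g xs) \<ominus>\<^sub>c ?F (?G ?b))"
    by (simp add: push_diff push_map_bd)
  finally have B: "boundary (prism f g (x # xs)) =
      basis (g x # map g xs) \<ominus>\<^sub>c (basis (f x # map g xs) \<ominus>\<^sub>c ?F (?G ?b)) \<ominus>\<^sub>c
      (?h \<ominus>\<^sub>c (basis (f x # map g xs) \<ominus>\<^sub>c basis (f x # map f xs) \<ominus>\<^sub>c ?F (?H (bd xs))))" .
  have C: "c \<in> chains UNIV \<Longrightarrow> c s \<in> carrier R" for c :: "'x list \<Rightarrow> 'a" and s
    by (rule chains_carrier)
  have D: "c \<in> chains UNIV \<Longrightarrow> c s \<in> carrier R" for c :: "'y list \<Rightarrow> 'a" and s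
    by (rule chains_carrier)
  \<comment> \<open>Here \<open>v\<close> is the shared face \<open>f x # map g xs\<close>, which
    drops out; \<open>p\<close> and \<open>q\<close> are the terms over the boundary of
    \<open>xs\<close>.\<close>
  have alg: "u \<ominus> (v \<ominus> p) \<ominus> (h \<ominus> (v \<ominus> w \<ominus> q)) = u \<ominus> w \<ominus> (h \<ominus> (p \<ominus> q))"
    if "u \<in> carrier R" "v \<in> carrier R" "p \<in> carrier R" "h \<in> carrier R" "w \<in> carrier R" "q \<in> carrier R"
    for u v p h w q
    using that by algebra
  show ?case
    unfolding B H
    unfolding diff_chain_def list.map
    using Hbd b by (intro ext alg D) auto
qed

lemma prism_homotopy:
  assumes "z \<in> chains UNIV" "boundary z = zero_chain"
  shows "boundary (lift (prism f g) z) = push (map g) z \<ominus>\<^sub>c push (map f) z"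
proof -
  have H: "lift (prism f g) (bd s) \<in> chains UNIV" for s
    by (rule lift_closed[of _ UNIV]) auto
  have "boundary (lift (prism f g) z) =
      lift (\<lambda>s. basis (map g s) \<ominus>\<^sub>c basis (map f s) \<ominus>\<^sub>c lift (prism f g) (bd s)) z"
    by (simp add: boundary_lift[OF assms(1)] boundary_prism)
  also have "\<dots> = push (map g) z \<ominus>\<^sub>c push (map f) z \<ominus>\<^sub>c lift (\<lambda>s. lift (prism f g) (bd s)) z"
    using assms H by (simp add: lift_fun_diff push_def)
  also have "lift (\<lambda>s. lift (prism f g) (bd s)) z = lift (prism f g) (boundary z)"
    using assms(1) by (simp only: boundary_def lift_lift bd_closed_UNIV prism_closed_UNIV)
  finally show ?thesis
    using assms by simp
qed

section \<open>Chain arithmetic and inclusions that vanish in homology\<close>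

lemma zero_add_chain [simp]: "c \<in> chains UNIV \<Longrightarrow> zero_chain \<oplus>\<^sub>c c = c"
  by (auto simp: add_chain_def zero_chain_def chains_carrier)

lemma diff_add_cancel:
  "c \<in> chains UNIV \<Longrightarrow> d \<in> chains UNIV \<Longrightarrow> c \<ominus>\<^sub>c d \<oplus>\<^sub>c d = c"
  using chains_carrier[of c UNIV] chains_carrier[of d UNIV]
  by (auto simp: diff_chain_def add_chain_def minus_eq a_assoc l_neg)

lemma diff_chain_eq_zero:
  assumes "c \<in> chains UNIV" "d \<in> chains UNIV" "c \<ominus>\<^sub>c d = zero_chain"
  shows "c = d"
  using diff_add_cancel[OF assms(1,2)] assms by simp

lemma diff_diff_cancel:
  assumes "c \<in> chains UNIV" "d \<in> chains UNIV"
  shows "c \<ominus>\<^sub>c (c \<ominus>\<^sub>c d) = d"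
proof
  fix s
  have "c s \<in> carrier R" "d s \<in> carrier R" using assms by (simp_all add: chains_carrier[of _ UNIV])
  then show "(c \<ominus>\<^sub>c (c \<ominus>\<^sub>c d)) s = d s" unfolding diff_chain_def by algebra
qed

lemma diff_right_commute:
  assumes "c \<in> chains UNIV" "d \<in> chains UNIV" "e \<in> chains UNIV"
  shows "c \<ominus>\<^sub>c d \<ominus>\<^sub>c e = c \<ominus>\<^sub>c e \<ominus>\<^sub>c d"
proof
  fix s
  have "c s \<in> carrier R" "d s \<in> carrier R" "e s \<in> carrier R" using assms by (simp_all add: chains_carrier[of _ UNIV])
  then show "(c \<ominus>\<^sub>c d \<ominus>\<^sub>c e) s = (c \<ominus>\<^sub>c e \<ominus>\<^sub>c d) s" unfolding diff_chain_def by algebra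
qed

lemma lift_closed_UNIV [simp]:
  "c \<in> chains UNIV \<Longrightarrow> (\<And>s. f s \<in> chains UNIV) \<Longrightarrow> lift f c \<in> chains UNIV"
  by (rule lift_closed[of _ UNIV]) auto

lemma lift_cong_zero:
  assumes "c \<in> chains X" "\<And>s. s \<in> X \<Longrightarrow> f s = zero_chain" "\<And>s. f s \<in> chains UNIV"
  shows "lift f c = zero_chain"
  using lift_cong[of c X f "\<lambda>_. zero_chain"] assms chains_UNIV[OF assms(1)] by simp

text \<open>Chain-level form of a zero map on reduced homology. In use, \<open>X\<close> carries the
  cycles and \<open>Y\<close> the fillings, so \<open>Y\<close> consists of tuples one entry longer
  than those of \<open>X\<close>.\<close>

definition inessential :: "'x list set \<Rightarrow> 'x list set \<Rightarrow> bool" where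
  "inessential X Y \<longleftrightarrow>
     (\<forall>z\<in>chains X. boundary z = zero_chain \<longrightarrow> (\<exists>w\<in>chains Y. boundary w = z))"

lemma inessential_mono:
  "inessential X Y \<Longrightarrow> X' \<subseteq> X \<Longrightarrow> Y \<subseteq> Y' \<Longrightarrow> inessential X' Y'"
  unfolding inessential_def using chains_mono by meson

lemma inessentialD:
  "inessential X Y \<Longrightarrow> z \<in> chains X \<Longrightarrow> boundary z = zero_chain \<Longrightarrow> \<exists>w\<in>chains Y. boundary w = z"
  by (simp add: inessential_def)

end

section \<open>Translates and reduced homology\<close>

text \<open>The index \<open>m\<close> is the length of the tuples: the \<open>k\<close>-simplices of \<open>S \<cdot> E C\<close> are \<open>translates act S C (Suc k)\<close>.\<close>

definition translates :: "('g \<Rightarrow> 'x \<Rightarrow> 'x) \<Rightarrow> 'g set \<Rightarrow> 'x set \<Rightarrow> nat \<Rightarrow> 'x list set" where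
  "translates act S C m = {map (act g) xs |g xs. g \<in> S \<and> set xs \<subseteq> C \<and> length xs = m}"

lemma translates_mono: "S \<subseteq> S' \<Longrightarrow> C \<subseteq> C' \<Longrightarrow> translates act S C m \<subseteq> translates act S' C' m"
  unfolding translates_def by blast

lemma translates_length: "xs \<in> translates act S C m \<Longrightarrow> length xs = m"
  by (auto simp: translates_def)

lemma simplices_translates_E: "simplices (translates_E act S C) k = translates act S C (Suc k)"
  by (auto simp: translates_E_def translates_def E_sset_def)

lemma translates_sublist:
  assumes "xs \<in> translates act S C m" "set ys \<subseteq> set xs"
  shows "ys \<in> translates act S C (length ys)"
proof -
  obtain g as where g: "xs = map (act g) as" "g \<in> S" "set as \<subseteq> C"
    using assms(1) by (auto simp: translates_def)
  have "ys \<in> lists (act g ` set as)" using assms(2) g(1) by auto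
  then obtain bs where "ys = map (act g) bs" "bs \<in> lists (set as)"
    unfolding lists_image by blast
  with g show ?thesis by (auto simp: translates_def)
qed

text \<open>Each translate of E C is the full simplex on the vertex set g C, so membership is a
  matter of length and vertices. Carrier checks are made in this form.\<close>

lemma translates_iff: "xs \<in> translates act S C m \<longleftrightarrow> length xs = m \<and> (\<exists>g\<in>S. set xs \<subseteq> act g ` C)"
proof
  assume "xs \<in> translates act S C m"
  then obtain g ys where "g \<in> S" "xs = map (act g) ys" "set ys \<subseteq> C" "length ys = m"
    unfolding translates_def by blast
  then show "length xs = m \<and> (\<exists>g\<in>S. set xs \<subseteq> act g ` C)"
    by (intro conjI bexI[of _ g]) auto
next
  assume "length xs = m \<and> (\<exists>g\<in>S. set xs \<subseteq> act g ` C)"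
  then obtain g where g: "g \<in> S" "xs \<in> lists (act g ` C)" "length xs = m" by auto
  then obtain ys where "xs = map (act g) ys" "set ys \<subseteq> C"
    unfolding lists_image by auto
  with g show "xs \<in> translates act S C m" by (auto simp: translates_def)
qed

context cring_chains
begin

section \<open>The complex of tuples computes reduced simplicial homology\<close>

lemma chains_eq_sset_chains: "sset_chains R Y k = chains (simplices Y k)"
  by (simp add: sset_chains_def chains_def)

lemma push_Cons_apply:
  assumes "c \<in> chains UNIV"
  shows "push (Cons x) c t = (case t of [] \<Rightarrow> \<zero> | y # t' \<Rightarrow> if y = x then c t' else \<zero>)"
  using assms
proof (induction rule: chains_induct)
  case zero
  then show ?case by (simp only: push_zero) (simp add: zero_chain_def split: list.split)
next
  case (step c a s)
  have "push (Cons x) (c \<oplus>\<^sub>c scale_chain a (basis s)) = push (Cons x) c \<oplus>\<^sub>c scale_chain a (basis (x # s))"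
    using step by (simp add: push_def lift_add lift_scale)
  then show ?case
    using step by (auto simp: add_chain_def scale_chain_def basis_def split: list.split)
qed

text \<open>Deleting the first entry gives \<open>xs\<close>; deleting a later one keeps
  \<open>x\<close> and shifts the index by one, which flips the sign. With an arbitrary coefficient
  \<open>a\<close> in the induction, that sign is absorbed by passing to
  \<open>\<ominus> a\<close>.\<close>

lemma finsum_faces:
  assumes "a \<in> carrier R"
  shows "(\<Oplus>i\<in>{..<length s}. if take i s @ drop (Suc i) s = t then (if even i then a else \<ominus> a) else \<zero>)
    = a \<otimes> bd s t"
  using assms
proof (induction s arbitrary: a t)
  case Nil
  then show ?case by (simp add: zero_chain_def)
next
  case (Cons x xs)
  let ?f = "\<lambda>s t a i. if take i s @ drop (Suc i) s = t then (if even i then a else \<ominus> a) else \<zero>"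
  have C: "?f s t a i \<in> carrier R" if "a \<in> carrier R" for s :: "'c list" and t a i
    using that by simp
  have B: "bd xs u \<in> carrier R" for u
    by (rule chains_carrier[OF bd_closed_UNIV])
  have neg: "\<ominus> a \<in> carrier R" using Cons by simp
  have "(\<Oplus>i\<in>{..<length (x # xs)}. ?f (x # xs) t a i) =
      ?f (x # xs) t a 0 \<oplus> (\<Oplus>i\<in>Suc ` {..<length xs}. ?f (x # xs) t a i)"
    unfolding length_Cons lessThan_Suc_eq_insert_0
    using Cons.prems by (intro finsum_insert) auto
  also have "(\<Oplus>i\<in>Suc ` {..<length xs}. ?f (x # xs) t a i) = (\<Oplus>i\<in>{..<length xs}. ?f (x # xs) t a (Suc i))"
    using Cons.prems by (intro finsum_reindex) auto
  also have "\<dots> = \<ominus> a \<otimes> push (Cons x) (bd xs) t"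
  proof (cases "\<exists>t'. t = x # t'")
    case True
    then obtain t' where t: "t = x # t'" by blast
    have "(\<Oplus>i\<in>{..<length xs}. ?f (x # xs) t a (Suc i)) = (\<Oplus>i\<in>{..<length xs}. ?f xs t' (\<ominus> a) i)"
      using Cons.prems by (intro finsum_cong') (auto simp: t)
    also have "\<dots> = \<ominus> a \<otimes> bd xs t'"
      by (rule Cons.IH[OF neg])
    finally show ?thesis
      by (simp add: t push_Cons_apply)
  next
    case False
    then have "(\<Oplus>i\<in>{..<length xs}. ?f (x # xs) t a (Suc i)) = \<zero>"
      by (intro add.finprod_one_eqI) auto
    moreover have "push (Cons x) (bd xs) t = \<zero>"
      using False by (auto simp: push_Cons_apply split: list.split)
    ultimately show ?thesis using neg by simp
  qed
  also have "?f (x # xs) t a 0 \<oplus> \<ominus> a \<otimes> push (Cons x) (bd xs) t = a \<otimes> bd (x # xs) t"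
  proof -
    have p: "push (Cons x) (bd xs) t \<in> carrier R"
      by (rule chains_carrier[of _ UNIV]) simp
    show ?thesis
      using p Cons.prems by (simp add: diff_chain_def basis_def minus_eq r_distr l_minus r_minus)
  qed
  finally show ?case .
qed

lemma sset_boundary_eq:
  assumes c: "c \<in> chains X" and len: "\<And>s. s \<in> X \<Longrightarrow> length s = Suc k"
    and face: "\<And>i s. face Y k i s = take i s @ drop (Suc i) s"
  shows "sset_boundary R Y k c = boundary c"
proof
  fix t
  have "(\<Oplus>i\<in>{i. i \<le> k \<and> face Y k i s = t}. if even i then c s else \<ominus> c s) = c s \<otimes> bd s t"
    if "c s \<noteq> \<zero>" for s
  proof -
    have s: "length s = Suc k" using that c len by (auto simp: chains_def)
    have "(\<Oplus>i\<in>{i. i \<le> k \<and> face Y k i s = t}. if even i then c s else \<ominus> c s) =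
      (\<Oplus>i\<in>{..<length s}. if take i s @ drop (Suc i) s = t then (if even i then c s else \<ominus> c s) else \<zero>)"
      using chains_carrier[OF c]
      by (intro add.finprod_mono_neutral_cong_left) (auto simp: s face)
    then show ?thesis by (simp only: finsum_faces[OF chains_carrier[OF c]])
  qed
  moreover have "bd s t \<in> carrier R" for s
    by (rule chains_carrier[OF bd_closed_UNIV])
  ultimately show "sset_boundary R Y k c t = boundary c t"
    unfolding sset_boundary_def boundary_def lift_def
    using chains_carrier[OF c]
    by (intro finsum_cong') auto
qed

text \<open>A tuple of length one has \<open>[]\<close> as its only face. The augmentation is
  therefore the coefficient of the empty tuple, and the cycles in degree 0 are the reduced
  ones.\<close>

lemma boundary_augmentation:
  assumes c: "c \<in> chains X" and len: "\<And>s. s \<in> X \<Longrightarrow> length s = Suc 0"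
  shows "boundary c = scale_chain (sset_augmentation R c) (basis [])"
proof
  fix t
  have *: "bd s t = basis [] t" if "c s \<noteq> \<zero>" for s
  proof -
    have "length s = Suc 0" using that c len by (auto simp: chains_def)
    then obtain x where "s = [x]" by (auto simp: length_Suc_conv)
    then show ?thesis by simp
  qed
  have "boundary c t = (\<Oplus>s\<in>{s. c s \<noteq> \<zero>}. c s \<otimes> basis [] t)"
    unfolding boundary_def lift_def using chains_carrier[OF c] *
    by (intro finsum_cong') (auto simp: basis_def)
  also have "\<dots> = (\<Oplus>s\<in>{s. c s \<noteq> \<zero>}. c s) \<otimes> basis [] t"
    using chains_carrier[OF c] chains_finite[OF c]
    by (intro finsum_ldistr[symmetric]) (auto simp: basis_def)
  finally show "boundary c t = scale_chain (sset_augmentation R c) (basis []) t"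
    by (simp add: scale_chain_def sset_augmentation_def)
qed

lemma sset_reduced_cycles_translates:
  "sset_reduced_cycles R (translates_E act S C) k =
     {z \<in> chains (translates act S C (Suc k)). boundary z = zero_chain}" (is "?L = ?R")
proof -
  have "z \<in> ?L \<longleftrightarrow> z \<in> ?R" if z: "z \<in> chains (translates act S C (Suc k))" for z
  proof (cases k)
    case 0
    have "boundary z = scale_chain (sset_augmentation R z) (basis [])"
      using z translates_length by (intro boundary_augmentation) (auto simp: 0)
    moreover have "sset_augmentation R z \<in> carrier R"
      unfolding sset_augmentation_def using chains_carrier[OF z] by (intro finsum_closed) auto
    ultimately have "boundary z = zero_chain \<longleftrightarrow> sset_augmentation R z = \<zero>"
      by (auto simp: scale_chain_def basis_def zero_chain_def fun_eq_iff)
    then show ?thesis using z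
      by (simp add: sset_reduced_cycles_def 0 chains_eq_sset_chains simplices_translates_E)
  next
    case (Suc m)
    have "sset_boundary R (translates_E act S C) k z = boundary z"
      using z translates_length by (intro sset_boundary_eq) (auto simp: translates_E_def E_sset_def)
    then show ?thesis using z
      by (simp add: sset_reduced_cycles_def Suc chains_eq_sset_chains simplices_translates_E zero_chain_def)
  qed
  moreover have "?L \<subseteq> chains (translates act S C (Suc k))"
    by (auto simp: sset_reduced_cycles_def chains_eq_sset_chains simplices_translates_E)
  ultimately show ?thesis by blast
qed

lemma sset_boundaries_translates:
  "sset_boundaries R (translates_E act S C) k = boundary ` chains (translates act S C (Suc (Suc k)))"
proof -
  have "sset_boundary R (translates_E act S C) (Suc k) w = boundary w"
    if "w \<in> chains (translates act S C (Suc (Suc k)))" for w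
    using that translates_length by (intro sset_boundary_eq) (auto simp: translates_E_def E_sset_def)
  then show ?thesis
    by (simp add: sset_boundaries_def chains_eq_sset_chains simplices_translates_E)
qed

text \<open>Removes quotient groups from the argument. A cycle lies in its own coset, so a vanishing
  class makes it a boundary in \<open>Z\<close>; conversely, all members of the coset of such a
  cycle are boundaries in \<open>Z\<close>, and the coset of a boundary is the whole group of
  boundaries.\<close>

lemma inclusion_induced_zero_iff:
  fixes act :: "'g \<Rightarrow> 'x \<Rightarrow> 'x" and S :: "'g set"
  assumes CD: "C \<subseteq> D"
  defines "Y \<equiv> translates_E act S C" and "Z \<equiv> translates_E act S D"
  shows "(\<forall>\<xi>\<in>carrier (sset_reduced_homology R Y k).
        sset_inclusion_induced R Y Z k \<xi> = \<one>\<^bsub>sset_reduced_homology R Z k\<^esub>) \<longleftrightarrow>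
      inessential (translates act S C (Suc k)) (translates act S D (Suc (Suc k)))"
proof -
  let ?B = "\<lambda>Y. sset_boundaries R Y k"
  let ?cos = "\<lambda>Y z. (\<lambda>b. b \<oplus>\<^sub>c z) ` ?B Y"
  have cos: "?B X #>\<^bsub>sset_reduced_cycle_group R X k\<^esub> z = ?cos X z" for X :: "'x list sset" and z
    by (auto simp: r_coset_def sset_reduced_cycle_group_def add_chain_def)
  have car: "carrier (sset_reduced_homology R Y k) = ?cos Y ` sset_reduced_cycles R Y k"
    by (auto simp: sset_reduced_homology_def FactGroup_def RCOSETS_def cos[symmetric])
      (auto simp: sset_reduced_cycle_group_def)
  have one: "\<one>\<^bsub>sset_reduced_homology R Z k\<^esub> = ?B Z"
    by (simp add: sset_reduced_homology_def FactGroup_def)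
  have ind: "sset_inclusion_induced R Y Z k \<xi> = (\<Union>z\<in>\<xi>. ?cos Z z)" for \<xi>
    by (simp add: sset_inclusion_induced_def cos)
  have B: "?B Z = boundary ` chains (translates act S D (Suc (Suc k)))"
    "?B Y = boundary ` chains (translates act S C (Suc (Suc k)))"
    unfolding Y_def Z_def by (rule sset_boundaries_translates)+
  have sub: "?B Y \<subseteq> ?B Z"
    unfolding B using CD chains_mono translates_mono by (metis image_mono subsetI subset_refl)
  have zeroB: "zero_chain \<in> ?B X" if "X = Y \<or> X = Z" for X
    using that B by (metis boundary_zero image_eqI zero_chain_closed)
  have addB: "b \<oplus>\<^sub>c b' \<in> ?B Z" if "b \<in> ?B Z" "b' \<in> ?B Z" for b b'
    using that unfolding B
    by (auto simp: boundary_add[symmetric] chains_UNIV intro!: imageI)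
  have diffB: "b \<ominus>\<^sub>c b' \<in> ?B Z" if "b \<in> ?B Z" "b' \<in> ?B Z" for b b'
    using that unfolding B
    by (auto simp: boundary_diff[symmetric] chains_UNIV intro!: imageI)
  have Bch: "b \<in> chains UNIV" if "b \<in> ?B Z" for b
    using that unfolding B by (auto intro: boundary_closed_UNIV chains_UNIV)
  have zero_add: "zero_chain \<oplus>\<^sub>c z = z" if "z \<in> chains UNIV" for z :: "'x list \<Rightarrow> 'a"
    using that by (auto simp: add_chain_def zero_chain_def chains_carrier)
  have cyc: "z \<in> chains UNIV" if "z \<in> sset_reduced_cycles R Y k" for z
    using that unfolding Y_def sset_reduced_cycles_translates by (auto intro: chains_UNIV)
  have "(\<forall>\<xi>\<in>carrier (sset_reduced_homology R Y k).
      sset_inclusion_induced R Y Z k \<xi> = \<one>\<^bsub>sset_reduced_homology R Z k\<^esub>) \<longleftrightarrow>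
     (\<forall>z\<in>sset_reduced_cycles R Y k. z \<in> ?B Z)"
    unfolding car one ind ball_simps
  proof (intro ball_cong refl iffI)
    fix z assume z: "z \<in> sset_reduced_cycles R Y k"
    {
      assume *: "(\<Union>z\<in>?cos Y z. ?cos Z z) = ?B Z"
      have "z \<in> ?cos Y z" using zeroB[of Y] zero_add[OF cyc[OF z]] by (metis image_eqI)
      moreover have "z \<in> ?cos Z z" using zeroB[of Z] zero_add[OF cyc[OF z]] by (metis image_eqI)
      ultimately show "z \<in> ?B Z" using * by blast
    next
      assume zB: "z \<in> ?B Z"
      have "?cos Z y = ?B Z" if y: "y \<in> ?B Z" for y
      proof
        show "?cos Z y \<subseteq> ?B Z" using addB y by blast
        show "?B Z \<subseteq> ?cos Z y"
        proof
          fix b assume b: "b \<in> ?B Z"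
          have "(b \<ominus>\<^sub>c y) \<oplus>\<^sub>c y = b"
            using chains_carrier[OF Bch[OF b]] chains_carrier[OF Bch[OF y]]
            by (auto simp: add_chain_def diff_chain_def minus_eq a_assoc l_neg)
          then show "b \<in> ?cos Z y" using diffB[OF b y] by (metis image_eqI)
        qed
      qed
      moreover have "?cos Y z \<subseteq> ?B Z" using addB sub zB by blast
      ultimately have "(\<Union>y\<in>?cos Y z. ?cos Z y) = (\<Union>y\<in>?cos Y z. ?B Z)"
        by (intro SUP_cong refl) blast
      also have "\<dots> = ?B Z" using zeroB[of Y] by blast
      finally show "(\<Union>z\<in>?cos Y z. ?cos Z z) = ?B Z" .
    }
  qed
  also have "\<dots> \<longleftrightarrow> inessential (translates act S C (Suc k)) (translates act S D (Suc (Suc k)))"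
    unfolding B inessential_def unfolding Y_def sset_reduced_cycles_translates by (auto simp: image_iff)
  finally show ?thesis .
qed

lemma essentially_acyclic_translates_iff:
  "essentially_acyclic R m A (\<subseteq>) (translates_E act S) \<longleftrightarrow>
     (\<forall>k. int k \<le> m \<longrightarrow> (\<forall>C\<in>A. \<exists>D\<in>A. C \<subseteq> D \<and>
        inessential (translates act S C (Suc k)) (translates act S D (Suc (Suc k)))))"
  unfolding essentially_acyclic_def
  by (intro all_cong ball_cong bex_cong conj_cong refl inclusion_induced_zero_iff imp_cong)

end

section \<open>Comparison of the filtrations\<close>

lemma set_multI: "h \<in> H \<Longrightarrow> k \<in> K \<Longrightarrow> h \<otimes>\<^bsub>G\<^esub> k \<in> H <#>\<^bsub>G\<^esub> K"
  by (auto simp: set_mult_def)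

text \<open>The situation with the topology abstracted away: \<open>K\<close> stands for the compact
  subsets and \<open>P\<close> for the half-space of the character. \<open>K_Int\<close> reflects
  that \<open>L\<close> is closed, \<open>K_comm\<close> is almost commutation, and
  \<open>fill_L\<close> is the finiteness type of \<open>L\<close> expressed with compact subsets of
  the big group lying in \<open>L\<close>.\<close>

locale coset_filtration = R: cring_chains R + G: group G
  for R :: "('r, 'p) ring_scheme" and G :: "('g, 'm) monoid_scheme" (structure) +
  fixes L P :: "'g set" and K :: "'g set set" and n :: nat
  assumes subgroup_L: "subgroup L G"
    and P_sub: "P \<subseteq> carrier G"
    and P_mult: "\<And>g h. g \<in> P \<Longrightarrow> h \<in> P \<Longrightarrow> g \<otimes> h \<in> P"
    and L_sub_P: "L \<subseteq> P"
    and K_sub: "\<And>C. C \<in> K \<Longrightarrow> C \<subseteq> carrier G"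
    and K_Un: "\<And>C D. C \<in> K \<Longrightarrow> D \<in> K \<Longrightarrow> C \<union> D \<in> K"
    and K_mult: "\<And>C D. C \<in> K \<Longrightarrow> D \<in> K \<Longrightarrow> C <#> D \<in> K"
    and K_inv: "\<And>C. C \<in> K \<Longrightarrow> m_inv G ` C \<in> K"
    and K_Int: "\<And>C. C \<in> K \<Longrightarrow> C \<inter> L \<in> K"
    and K_comm: "\<And>C. C \<in> K \<Longrightarrow> \<exists>C'\<in>K. C <#> L \<subseteq> L <#> C' \<and> L <#> C \<subseteq> C' <#> L"
    and fill_L: "\<And>k C. k < n \<Longrightarrow> C \<in> K \<Longrightarrow> C \<subseteq> L \<Longrightarrow> \<exists>D\<in>K. D \<subseteq> L \<and> C \<subseteq> D \<and>
      R.inessential (translates (\<lambda>g x. g \<otimes> x) L C (Suc k)) (translates (\<lambda>g x. g \<otimes> x) L D (Suc (Suc k)))"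
begin

section \<open>Fillings inside the translates g L.E(D)\<close>

abbreviation tr :: "'g set \<Rightarrow> 'g set \<Rightarrow> nat \<Rightarrow> 'g list set" where
  "tr \<equiv> translates (\<lambda>g x. g \<otimes> x)"

lemma L_sub: "L \<subseteq> carrier G"
  using subgroup_L by (rule subgroup.subset)

lemma L_carrier: "l \<in> L \<Longrightarrow> l \<in> carrier G"
  using L_sub by blast

lemma P_carrier: "g \<in> P \<Longrightarrow> g \<in> carrier G"
  using P_sub by blast

lemma K_carrier: "C \<in> K \<Longrightarrow> x \<in> C \<Longrightarrow> x \<in> carrier G"
  using K_sub by blast

lemmas L_closed = subgroup.m_closed[OF subgroup_L] subgroup.m_inv_closed[OF subgroup_L]
  subgroup.one_closed[OF subgroup_L]

text \<open>\<open>fill_L\<close> only speaks of sets inside \<open>L\<close>, while D is arbitrary.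
  The map \<open>r\<close> sends L D to \<open>L\<close>, commutes with left multiplication by
  \<open>L\<close>, and displaces points by elements of a compact set. So a cycle is pushed into
  \<open>L\<close>, filled there, and joined to the original by a prism.\<close>

lemma fill_L_translates:
  assumes k: "k < n" and D: "D \<in> K"
  shows "\<exists>D'\<in>K. D \<subseteq> D' \<and> R.inessential (tr L D (Suc k)) (tr L D' (Suc (Suc k)))"
proof -
  \<comment> \<open>The chosen point of \<open>D\<close> depends only on the right coset
    \<open>L #> x\<close>; this makes \<open>r\<close> commute with \<open>L\<close>.\<close>
  define s where "s x = (SOME d. d \<in> D \<and> d \<in> L #> x)" for x
  define r where "r x = x \<otimes> inv (s x)" for x
  \<comment> \<open>For \<open>d\<close> in \<open>D\<close> one has
    \<open>s d = l \<otimes> d\<close> with \<open>l\<close> in \<open>L\<close>, so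
    \<open>r d\<close> is the inverse of \<open>l\<close>: an element of \<open>L\<close> that is
    also a quotient of two elements of \<open>D\<close>.\<close>
  define K0 where "K0 = (D <#> m_inv G ` D) \<inter> L"
  have K0: "K0 \<in> K" "K0 \<subseteq> L"
    using D K_mult K_inv K_Int by (auto simp: K0_def)
  have s: "s x \<in> D \<and> s x \<in> L #> x" if "l \<in> L" "d \<in> D" "x = l \<otimes> d" for l d x
  proof -
    have "d = inv l \<otimes> x"
      using that L_carrier K_carrier[OF D] by (simp add: G.inv_solve_left)
    then have "d \<in> L #> x" using that L_closed by (auto simp: r_coset_def)
    then show ?thesis unfolding s_def using that(2) by (metis (mono_tags, lifting) someI_ex)
  qed
  have s_mult: "s (l \<otimes> x) = s x" if "l \<in> L" "x \<in> carrier G" for l x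
  proof -
    have "L #> (l \<otimes> x) = L #> x"
      using that subgroup_L L_sub L_carrier by (metis G.coset_join2 G.coset_mult_assoc)
    then show ?thesis by (simp add: s_def)
  qed
  have r_mult: "r (l \<otimes> x) = l \<otimes> r x" if "l \<in> L" "x \<in> D" for l x
  proof -
    have "s x \<in> carrier G"
      using s[of "\<one>" x x] that L_closed K_carrier[OF D] by auto
    then show ?thesis
      using that L_carrier K_carrier[OF D] by (simp add: r_def s_mult G.m_assoc)
  qed
  have r_D: "r d \<in> K0" if d: "d \<in> D" for d
  proof -
    have *: "s d \<in> D" "s d \<in> L #> d"
      using s[of "\<one>" d d] d L_closed K_carrier[OF D] by auto
    then obtain l where l: "l \<in> L" "s d = l \<otimes> d" by (auto simp: r_coset_def)
    have "r d = inv l"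
      using l d L_carrier K_carrier[OF D] by (simp add: r_def G.inv_mult_group G.m_assoc[symmetric])
    then have "r d \<in> L" using l L_closed by simp
    moreover have "r d \<in> D <#> m_inv G ` D"
      using * d by (auto simp: r_def set_mult_def)
    ultimately show ?thesis by (simp add: K0_def)
  qed
  obtain K1 where K1: "K1 \<in> K" "K0 \<subseteq> K1"
    and fill: "R.inessential (tr L K0 (Suc k)) (tr L K1 (Suc (Suc k)))"
    using fill_L[OF k K0] by blast
  let ?D = "D \<union> K1"
  have "R.inessential (tr L D (Suc k)) (tr L ?D (Suc (Suc k)))"
    unfolding R.inessential_def
  proof (intro ballI impI)
    fix z assume z: "z \<in> R.chains (tr L D (Suc k))" and bz: "R.boundary z = R.zero_chain"
    note zU = R.chains_UNIV[OF z]
    have map_r: "map r xs \<in> tr L K0 (Suc k)" if "xs \<in> tr L D (Suc k)" for xs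
    proof -
      obtain l where l: "l \<in> L" "length xs = Suc k" "set xs \<subseteq> (\<lambda>x. l \<otimes> x) ` D"
        using \<open>xs \<in> _\<close> by (auto simp: translates_iff)
      have "r x \<in> (\<lambda>x. l \<otimes> x) ` K0" if x: "x \<in> set xs" for x
      proof -
        obtain d where "d \<in> D" "x = l \<otimes> d" using l(3) x by blast
        then show ?thesis using l(1) r_mult r_D by auto
      qed
      then have "set (map r xs) \<subseteq> (\<lambda>x. l \<otimes> x) ` K0" by auto
      then show ?thesis using l by (auto simp: translates_iff)
    qed
    have "R.push (map r) z \<in> R.chains (tr L K0 (Suc k))"
      using z map_r by (rule R.push_closed)
    moreover have "R.boundary (R.push (map r) z) = R.zero_chain"
      using bz by (simp add: R.boundary_push_map[OF zU])
    ultimately obtain w where w: "w \<in> R.chains (tr L K1 (Suc (Suc k)))"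
      and bw: "R.boundary w = R.push (map r) z"
      using fill by (auto simp: R.inessential_def)
    \<comment> \<open>Over a simplex of l.E(D) the prism has its vertices in l D and l K0, hence
      stays in the single translate l.E(D \<union> K1).\<close>
    let ?H = "R.lift (R.prism r (\<lambda>x. x)) z"
    have H: "?H \<in> R.chains (tr L ?D (Suc (Suc k)))"
    proof (rule R.lift_closed[OF z])
      fix xs assume xs: "xs \<in> tr L D (Suc k)"
      obtain l where l: "l \<in> L" "length xs = Suc k" "set xs \<subseteq> (\<lambda>x. l \<otimes> x) ` D"
        using xs by (auto simp: translates_iff)
      have "r x \<in> (\<lambda>x. l \<otimes> x) ` ?D" "x \<in> (\<lambda>x. l \<otimes> x) ` ?D" if x: "x \<in> set xs" for x
      proof -
        obtain d where d: "d \<in> D" "x = l \<otimes> d" using l(3) x by blast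
        then have "r x = l \<otimes> r d" "r d \<in> ?D" using l(1) r_mult r_D K1(2) by auto
        then show "r x \<in> (\<lambda>x. l \<otimes> x) ` ?D" by (rule image_eqI)
        show "x \<in> (\<lambda>x. l \<otimes> x) ` ?D" using d by blast
      qed
      then have sub: "r ` set xs \<union> (\<lambda>x. x) ` set xs \<subseteq> (\<lambda>x. l \<otimes> x) ` ?D" by blast
      have "ys \<in> tr L ?D (Suc (Suc k))"
        if ys: "set ys \<subseteq> r ` set xs \<union> (\<lambda>x. x) ` set xs \<and> length ys = Suc (length xs)" for ys
      proof -
        have "set ys \<subseteq> (\<lambda>x. l \<otimes> x) ` ?D" using ys sub by (meson order_trans)
        then show ?thesis unfolding translates_iff using ys l(1,2) by (intro conjI bexI[of _ l]) simp_all
      qed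
      then show "R.prism r (\<lambda>x. x) xs \<in> R.chains (tr L ?D (Suc (Suc k)))"
        by (intro R.chains_mono[OF R.prism_closed] subsetI) (simp only: mem_Collect_eq)
    qed simp
    have bH: "R.boundary ?H = z \<ominus>\<^sub>c R.push (map r) z"
      using R.prism_homotopy[OF zU bz, of r "\<lambda>x. x"] R.push_id[OF z, of "map (\<lambda>x. x)"] by simp
    have w': "w \<in> R.chains (tr L ?D (Suc (Suc k)))"
      using w translates_mono[of L L K1 ?D] by (rule R.chains_mono) auto
    have "R.boundary (?H \<oplus>\<^sub>c w) = z"
      using H w' zU by (simp add: R.boundary_add R.chains_UNIV bH bw R.diff_add_cancel)
    then show "\<exists>w\<in>R.chains (tr L ?D (Suc (Suc k))). R.boundary w = z"
      using H w' by (metis R.add_chain_closed)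
  qed
  then show ?thesis using K_Un[OF D K1(1)] by blast
qed

text \<open>Left multiplication by g identifies L.E(D) with g L.E(D), so the set found for
  \<open>L\<close> serves all g at once. This uniformity keeps the deformation within one compact
  set.\<close>

lemma fill_carrier:
  assumes k: "k < n" and D: "D \<in> K"
  shows "\<exists>D'\<in>K. D \<subseteq> D' \<and>
    (\<forall>g\<in>carrier G. R.inessential (tr (g <# L) D (Suc k)) (tr (g <# L) D' (Suc (Suc k))))"
proof -
  obtain D' where D': "D' \<in> K" "D \<subseteq> D'"
    and fill: "R.inessential (tr L D (Suc k)) (tr L D' (Suc (Suc k)))"
    using fill_L_translates[OF assms] by blast
  have "R.inessential (tr (g <# L) D (Suc k)) (tr (g <# L) D' (Suc (Suc k)))" if g: "g \<in> carrier G" for g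
    unfolding R.inessential_def
  proof (intro ballI impI)
    fix z assume z: "z \<in> R.chains (tr (g <# L) D (Suc k))" and bz: "R.boundary z = R.zero_chain"
    note zU = R.chains_UNIV[OF z]
    let ?z = "R.push (map (\<lambda>x. inv g \<otimes> x)) z"
    have to_L: "map (\<lambda>x. inv g \<otimes> x) xs \<in> tr L D (Suc k)" if xs: "xs \<in> tr (g <# L) D (Suc k)" for xs
    proof -
      obtain l where l: "l \<in> L" "length xs = Suc k" "set xs \<subseteq> (\<lambda>x. g \<otimes> l \<otimes> x) ` D"
        using xs by (auto simp: translates_iff l_coset_def)
      have "inv g \<otimes> (g \<otimes> l \<otimes> d) = l \<otimes> d" if "d \<in> D" for d
        using that g l L_carrier K_carrier[OF D] by (simp add: G.m_assoc[symmetric])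
      then have "set (map (\<lambda>x. inv g \<otimes> x) xs) \<subseteq> (\<lambda>x. l \<otimes> x) ` D"
        using l by fastforce
      then show ?thesis using l by (auto simp: translates_iff)
    qed
    have from_L: "map (\<lambda>x. g \<otimes> x) xs \<in> tr (g <# L) D' (Suc (Suc k))" if xs: "xs \<in> tr L D' (Suc (Suc k))" for xs
    proof -
      obtain l where l: "l \<in> L" "length xs = Suc (Suc k)" "set xs \<subseteq> (\<lambda>x. l \<otimes> x) ` D'"
        using xs by (auto simp: translates_iff)
      have "g \<otimes> (l \<otimes> d) = g \<otimes> l \<otimes> d" if "d \<in> D'" for d
        using that g l L_carrier K_carrier[OF D'(1)] by (simp add: G.m_assoc)
      then have "set (map (\<lambda>x. g \<otimes> x) xs) \<subseteq> (\<lambda>x. g \<otimes> l \<otimes> x) ` D'"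
        using l by fastforce
      then show ?thesis using l by (auto simp: translates_iff l_coset_def)
    qed
    have "?z \<in> R.chains (tr L D (Suc k))"
      using z to_L by (rule R.push_closed)
    moreover have "R.boundary ?z = R.zero_chain"
      using bz by (simp add: R.boundary_push_map[OF zU])
    ultimately obtain w where w: "w \<in> R.chains (tr L D' (Suc (Suc k)))" and bw: "R.boundary w = ?z"
      using fill by (auto simp: R.inessential_def)
    have id: "map (\<lambda>x. g \<otimes> x) (map (\<lambda>x. inv g \<otimes> x) xs) = xs" if xs: "xs \<in> tr (g <# L) D (Suc k)" for xs
    proof -
      have "set xs \<subseteq> carrier G"
        using xs g L_carrier K_carrier[OF D] by (fastforce simp: translates_iff l_coset_def)
      then show ?thesis
        using g by (auto simp: G.m_assoc[symmetric] intro!: map_idI)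
    qed
    have "R.boundary (R.push (map (\<lambda>x. g \<otimes> x)) w) = R.push (map (\<lambda>x. g \<otimes> x)) ?z"
      by (simp add: R.boundary_push_map[OF R.chains_UNIV[OF w]] bw)
    also have "\<dots> = z"
      unfolding R.push_push[OF zU] using z id by (rule R.push_id)
    finally have "R.boundary (R.push (map (\<lambda>x. g \<otimes> x)) w) = z" .
    moreover have "R.push (map (\<lambda>x. g \<otimes> x)) w \<in> R.chains (tr (g <# L) D' (Suc (Suc k)))"
      using w from_L by (rule R.push_closed)
    ultimately show "\<exists>w\<in>R.chains (tr (g <# L) D' (Suc (Suc k))). R.boundary w = z" by blast
  qed
  then show ?thesis using D' by blast
qed

text \<open>The carriers of a simplex do not depend, up to enlarging the compact set, on the group element
  used to write it as a translate.\<close>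

lemma change_translate:
  assumes C: "C \<in> K" and E: "E \<in> K"
  shows "\<exists>E'\<in>K. E \<subseteq> E' \<and> (\<forall>g\<in>carrier G. \<forall>g'\<in>carrier G. \<forall>x l.
     x \<in> g <# (C <#> L) \<and> x \<in> g' <# (C <#> L) \<longrightarrow>
     tr (g' <# L) E l \<subseteq> tr (g <# L) E' l \<and> tr {g'} (E <#> L) l \<subseteq> tr {g} (E' <#> L) l)"
proof -
  \<comment> \<open>A common vertex gives g' = g c l3 c'^-1 with l3 in \<open>L\<close>.
    \<open>E1\<close> and \<open>E2\<close> serve to move c'^-1 and then c to the right past
    \<open>L\<close>, leading to E2 E1 E; \<open>E3\<close> serves to move l3 to the right past
    c'^-1 E, leading to C E3.\<close>
  obtain E1 where E1: "E1 \<in> K" "(m_inv G ` C) <#> L \<subseteq> L <#> E1"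
    using K_comm[OF K_inv[OF C]] by blast
  obtain E2 where E2: "E2 \<in> K" "C <#> L \<subseteq> L <#> E2"
    using K_comm[OF C] by blast
  obtain E3 where E3: "E3 \<in> K" "L <#> ((m_inv G ` C) <#> E) \<subseteq> E3 <#> L"
    using K_comm[OF K_mult[OF K_inv[OF C] E]] by blast
  note car = L_carrier K_carrier[OF C] K_carrier[OF E] K_carrier[OF E1(1)] K_carrier[OF E2(1)]
    K_carrier[OF E3(1)] P_carrier
  let ?E = "E \<union> (E2 <#> E1 <#> E) \<union> (C <#> E3)"
  have key: "tr (g' <# L) E l \<subseteq> tr (g <# L) ?E l \<and> tr {g'} (E <#> L) l \<subseteq> tr {g} (?E <#> L) l"
    if g: "g \<in> carrier G" "g' \<in> carrier G" and x: "x \<in> g <# (C <#> L)" "x \<in> g' <# (C <#> L)" for g g' x l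
  proof -
    obtain c l1 c' l2 where cl: "c \<in> C" "l1 \<in> L" "c' \<in> C" "l2 \<in> L"
      "x = g \<otimes> (c \<otimes> l1)" "x = g' \<otimes> (c' \<otimes> l2)"
      using x by (auto simp: l_coset_def set_mult_def)
    define l3 where "l3 = l1 \<otimes> inv l2"
    have l3: "l3 \<in> L" using cl L_closed by (simp add: l3_def)
    have "g' = x \<otimes> inv (c' \<otimes> l2)"
      using G.inv_solve_right[of g' x "c' \<otimes> l2"] cl(6) cl(1-4) g car by simp
    then have g': "g' = g \<otimes> (c \<otimes> (l3 \<otimes> inv c'))"
      using cl g car by (simp add: l3_def G.inv_mult_group G.m_assoc)
    have "tr (g' <# L) E l \<subseteq> tr (g <# L) ?E l"
    proof
      fix xs assume "xs \<in> tr (g' <# L) E l"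
      then obtain l4 where l4: "l4 \<in> L" "length xs = l" "set xs \<subseteq> (\<lambda>x. g' \<otimes> l4 \<otimes> x) ` E"
        by (auto simp: translates_iff l_coset_def)
      have "inv c' \<otimes> l4 \<in> L <#> E1"
        using cl l4 by (intro subsetD[OF E1(2)] set_multI imageI)
      then obtain l5 e1 where e1: "l5 \<in> L" "e1 \<in> E1" "inv c' \<otimes> l4 = l5 \<otimes> e1"
        by (auto simp: set_mult_def)
      have "c \<otimes> (l3 \<otimes> l5) \<in> L <#> E2"
        using set_multI[OF cl(1) L_closed(1)[OF l3 e1(1)]] by (rule subsetD[OF E2(2)])
      then obtain l6 e2 where e2: "l6 \<in> L" "e2 \<in> E2" "c \<otimes> (l3 \<otimes> l5) = l6 \<otimes> e2"
        by (auto simp: set_mult_def)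
      have "g' \<otimes> l4 \<otimes> d = g \<otimes> l6 \<otimes> (e2 \<otimes> e1 \<otimes> d)" if d: "d \<in> E" for d
      proof -
        have "g' \<otimes> l4 \<otimes> d = g \<otimes> (c \<otimes> (l3 \<otimes> ((inv c' \<otimes> l4) \<otimes> d)))"
          unfolding g' using d g cl l3 l4 car by (simp add: G.m_assoc)
        also have "\<dots> = g \<otimes> ((c \<otimes> (l3 \<otimes> l5)) \<otimes> (e1 \<otimes> d))"
          unfolding e1(3) using d g cl l3 e1 car by (simp add: G.m_assoc)
        also have "\<dots> = g \<otimes> l6 \<otimes> (e2 \<otimes> e1 \<otimes> d)"
          unfolding e2(3) using d g e1 e2 car by (simp add: G.m_assoc)
        finally show ?thesis .
      qed
      moreover have "e2 \<otimes> e1 \<otimes> d \<in> ?E" if "d \<in> E" for d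
        using set_multI[OF set_multI[OF e2(2) e1(2)] that] by blast
      ultimately have "(\<lambda>x. g' \<otimes> l4 \<otimes> x) ` E \<subseteq> (\<lambda>x. g \<otimes> l6 \<otimes> x) ` ?E"
        by (intro image_subsetI image_eqI)
      then have "set xs \<subseteq> (\<lambda>x. g \<otimes> l6 \<otimes> x) ` ?E"
        by (rule order_trans[OF l4(3)])
      moreover have "g \<otimes> l6 \<in> g <# L" using e2(1) by (auto simp: l_coset_def)
      ultimately show "xs \<in> tr (g <# L) ?E l"
        unfolding translates_iff using l4(2) by (intro conjI bexI)
    qed
    moreover have "tr {g'} (E <#> L) l \<subseteq> tr {g} (?E <#> L) l"
    proof -
      have "g' \<otimes> y \<in> (\<lambda>x. g \<otimes> x) ` (?E <#> L)" if y: "y \<in> E <#> L" for y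
      proof -
        obtain d l4 where d: "d \<in> E" "l4 \<in> L" "y = d \<otimes> l4"
          using y by (auto simp: set_mult_def)
        have "l3 \<otimes> (inv c' \<otimes> d) \<in> E3 <#> L"
          using l3 cl d by (intro subsetD[OF E3(2)] set_multI imageI)
        then obtain e3 l5 where e3: "e3 \<in> E3" "l5 \<in> L" "l3 \<otimes> (inv c' \<otimes> d) = e3 \<otimes> l5"
          by (auto simp: set_mult_def)
        have "g' \<otimes> y = g \<otimes> (c \<otimes> ((l3 \<otimes> (inv c' \<otimes> d)) \<otimes> l4))"
          unfolding g' using d g cl l3 car by (simp add: G.m_assoc)
        also have "\<dots> = g \<otimes> ((c \<otimes> e3) \<otimes> (l5 \<otimes> l4))"
          unfolding e3(3) using d g cl e3 car by (simp add: G.m_assoc)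
        finally have "g' \<otimes> y = g \<otimes> ((c \<otimes> e3) \<otimes> (l5 \<otimes> l4))" .
        moreover have "(c \<otimes> e3) \<otimes> (l5 \<otimes> l4) \<in> ?E <#> L"
        proof -
          have "c \<otimes> e3 \<in> ?E" using set_multI[OF cl(1) e3(1)] by blast
          moreover have "l5 \<otimes> l4 \<in> L" using e3 d L_closed by blast
          ultimately show ?thesis by (rule set_multI)
        qed
        ultimately show ?thesis by (rule image_eqI)
      qed
      then have "(\<lambda>x. g' \<otimes> x) ` (E <#> L) \<subseteq> (\<lambda>x. g \<otimes> x) ` (?E <#> L)" by (rule image_subsetI)
      then have "set xs \<subseteq> (\<lambda>x. g \<otimes> x) ` (?E <#> L)" if "set xs \<subseteq> (\<lambda>x. g' \<otimes> x) ` (E <#> L)" for xs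
        using that by (rule order_trans[rotated])
      then show ?thesis by (intro subsetI) (simp add: translates_iff)
    qed
    ultimately show ?thesis by (rule conjI)
  qed
  have "?E \<in> K"
    using C E E1 E2 E3 K_mult K_Un by simp
  then show ?thesis
    by (intro bexI[of _ ?E] conjI[OF _ ballI] ballI allI impI, blast, elim conjE, intro key)
qed

text \<open>A truncated deformation of the chains of \<open>P \<cdot> E(C L)\<close> into those of \<open>P \<cdot> E D\<close>, relative to
  \<open>P \<cdot> E C\<close>: a simplex of \<open>g \<cdot> E(C L)\<close> is moved by \<open>\<phi>\<close> into \<open>g L \<cdot> E D\<close> through the homotopy \<open>h\<close>, which
  stays in \<open>g \<cdot> E(D L)\<close>. That \<open>\<phi>\<close> is a chain map is a consequence of the homotopy equation.\<close>

definition deformation ::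
  "'g set \<Rightarrow> nat \<Rightarrow> 'g set \<Rightarrow> ('g list \<Rightarrow> 'g list \<Rightarrow> 'r) \<Rightarrow> ('g list \<Rightarrow> 'g list \<Rightarrow> 'r) \<Rightarrow> bool" where
  "deformation C m D \<phi> h \<longleftrightarrow>
     (\<forall>\<sigma>. \<phi> \<sigma> \<in> R.chains UNIV) \<and> (\<forall>\<sigma>. h \<sigma> \<in> R.chains UNIV) \<and> h [] = R.zero_chain \<and>
     (\<forall>k\<le>m. \<forall>g\<in>P. \<forall>\<sigma>\<in>tr {g} (C <#> L) (Suc k).
        \<phi> \<sigma> \<in> R.chains (tr (g <# L) D (Suc k)) \<and>
        h \<sigma> \<in> R.chains (tr {g} (D <#> L) (Suc (Suc k))) \<and>
        R.boundary (h \<sigma>) = R.basis \<sigma> \<ominus>\<^sub>c \<phi> \<sigma> \<ominus>\<^sub>c R.lift h (R.bd \<sigma>)) \<and>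
     (\<forall>k\<le>m. \<forall>\<sigma>\<in>tr P C (Suc k). \<phi> \<sigma> = R.basis \<sigma> \<and> h \<sigma> = R.zero_chain)"

section \<open>The deformation, by induction on the dimension, and the comparison it yields\<close>

lemma translates_faces: "xs \<in> translates act S C (Suc m) \<Longrightarrow> R.bd xs \<in> R.chains (translates act S C m)"
  using translates_sublist translates_length
  by (intro R.chains_mono[OF R.bd_closed]) fastforce

lemma subset_set_mult_L: "C \<subseteq> carrier G \<Longrightarrow> C \<subseteq> C <#> L"
proof
  fix x assume "C \<subseteq> carrier G" "x \<in> C"
  then have "x = x \<otimes> \<one>" by auto
  then show "x \<in> C <#> L" using L_closed(3) \<open>x \<in> C\<close> unfolding set_mult_def by blast
qed

text \<open>Puts the carrier of \<open>\<phi>\<close> inside the acyclic carrier of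
  \<open>h\<close>, where differences can be coned off.\<close>

lemma translates_l_coset_subset:
  assumes "g \<in> carrier G" "E \<in> K" "L <#> E \<subseteq> S"
  shows "tr (g <# L) E l \<subseteq> tr {g} S l"
proof
  fix xs assume "xs \<in> tr (g <# L) E l"
  then obtain l4 where l4: "l4 \<in> L" "length xs = l" "set xs \<subseteq> (\<lambda>x. g \<otimes> l4 \<otimes> x) ` E"
    by (auto simp: translates_iff l_coset_def)
  have "g \<otimes> l4 \<otimes> x \<in> (\<lambda>x. g \<otimes> x) ` S" if x: "x \<in> E" for x
  proof -
    have "l4 \<otimes> x \<in> S" using l4 x by (intro subsetD[OF assms(3)]) (auto simp: set_mult_def)
    moreover have "g \<otimes> l4 \<otimes> x = g \<otimes> (l4 \<otimes> x)"
      using l4 x assms L_carrier K_carrier by (simp add: G.m_assoc)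
    ultimately show ?thesis by simp
  qed
  then show "xs \<in> tr {g} S l" using l4 by (fastforce simp: translates_iff)
qed

lemma deformation_0:
  assumes C: "C \<in> K"
  shows "\<exists>D\<in>K. \<exists>\<phi> h. deformation C 0 D \<phi> h"
proof -
  obtain D where D: "D \<in> K" "C <#> L \<subseteq> L <#> D"
    using K_comm[OF C] by blast
  have "\<sigma> \<in> tr (g <# L) D (Suc 0)" if g: "g \<in> P" and \<sigma>: "\<sigma> \<in> tr {g} (C <#> L) (Suc 0)" for g \<sigma>
  proof -
    obtain y where y: "\<sigma> = [g \<otimes> y]" "y \<in> C <#> L"
      using \<sigma> by (auto simp: translates_def length_Suc_conv)
    obtain l d where ld: "l \<in> L" "d \<in> D" "y = l \<otimes> d"
      using subsetD[OF D(2) y(2)] by (auto simp: set_mult_def)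
    have "\<sigma> = [g \<otimes> l \<otimes> d]"
      using y ld g P_carrier L_carrier K_carrier[OF D(1)] by (simp add: G.m_assoc)
    then show ?thesis using ld by (auto simp: translates_iff l_coset_def)
  qed
  moreover have "R.zero_chain = R.basis \<sigma> \<ominus>\<^sub>c R.basis \<sigma> \<ominus>\<^sub>c R.lift (\<lambda>_. R.zero_chain) (R.bd \<sigma>)" for \<sigma> :: "'g list"
    by simp
  ultimately have "deformation C 0 D R.basis (\<lambda>_. R.zero_chain)"
    unfolding deformation_def by simp
  then show ?thesis using D(1) by blast
qed

text \<open>The acyclic carrier step for one simplex and one fixed g. The image of the boundary is a
  cycle, filled by \<open>p\<close> using the acyclicity of g L.E(D); what the homotopy equation
  still lacks is then a cycle of the full simplex g.E(D3 L), filled by a cone.\<close>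

lemma deformation_fill:
  assumes def: "deformation C m D \<phi> h" and C: "C \<in> K" and D: "D \<in> K" "D \<subseteq> D2" "D2 \<in> K"
    and D3: "D3 \<in> K" "D2 \<subseteq> D3" "C \<subseteq> D3" "L <#> D2 \<subseteq> D3 <#> L"
    and fill: "R.inessential (tr (g <# L) D (Suc m)) (tr (g <# L) D2 (Suc (Suc m)))"
    and g: "g \<in> P" and \<sigma>: "\<sigma> \<in> tr {g} (C <#> L) (Suc (Suc m))"
  shows "\<exists>p q. p \<in> R.chains (tr (g <# L) D2 (Suc (Suc m))) \<and>
    q \<in> R.chains (tr {g} (D3 <#> L) (Suc (Suc (Suc m)))) \<and>
    R.boundary q = R.basis \<sigma> \<ominus>\<^sub>c p \<ominus>\<^sub>c R.lift h (R.bd \<sigma>)"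
proof -
  have U: "\<And>\<sigma>. \<phi> \<sigma> \<in> R.chains UNIV" "\<And>\<sigma>. h \<sigma> \<in> R.chains UNIV"
    using def by (auto simp: deformation_def)
  have def': "\<phi> \<tau> \<in> R.chains (tr (g <# L) D (Suc m)) \<and>
        h \<tau> \<in> R.chains (tr {g} (D <#> L) (Suc (Suc m))) \<and>
        R.boundary (h \<tau>) = R.basis \<tau> \<ominus>\<^sub>c \<phi> \<tau> \<ominus>\<^sub>c R.lift h (R.bd \<tau>)"
    if "\<tau> \<in> tr {g} (C <#> L) (Suc m)" for \<tau>
    using def g that by (auto simp: deformation_def)
  have bd: "R.bd \<sigma> \<in> R.chains (tr {g} (C <#> L) (Suc m))"
    using \<sigma> by (rule translates_faces)
  define c where "c = R.lift \<phi> (R.bd \<sigma>)"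
  define e where "e = R.lift h (R.bd \<sigma>)"
  have c: "c \<in> R.chains (tr (g <# L) D (Suc m))"
    unfolding c_def by (rule R.lift_closed[OF bd]) (use U def' in auto)
  have e: "e \<in> R.chains (tr {g} (D <#> L) (Suc (Suc m)))"
    unfolding e_def by (rule R.lift_closed[OF bd]) (use U def' in auto)
  note cU = R.chains_UNIV[OF c] and eU = R.chains_UNIV[OF e]
  have "R.boundary e = R.lift (\<lambda>\<tau>. R.boundary (h \<tau>)) (R.bd \<sigma>)"
    unfolding e_def by (rule R.boundary_lift) (use U in auto)
  also have "\<dots> = R.lift (\<lambda>\<tau>. R.basis \<tau> \<ominus>\<^sub>c \<phi> \<tau> \<ominus>\<^sub>c R.lift h (R.bd \<tau>)) (R.bd \<sigma>)"
    by (rule R.lift_cong[OF bd]) (use U def' in auto)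
  also have "\<dots> = R.bd \<sigma> \<ominus>\<^sub>c c \<ominus>\<^sub>c R.lift (\<lambda>\<tau>. R.lift h (R.bd \<tau>)) (R.bd \<sigma>)"
    using U by (simp add: R.lift_fun_diff c_def)
  also have "R.lift (\<lambda>\<tau>. R.lift h (R.bd \<tau>)) (R.bd \<sigma>) = R.lift h (R.boundary (R.bd \<sigma>))"
    unfolding R.boundary_def by (rule R.lift_lift[symmetric]) (use U in auto)
  finally have be: "R.boundary e = R.bd \<sigma> \<ominus>\<^sub>c c" using cU by simp
  \<comment> \<open>The chain \<open>u\<close> has boundary \<open>c\<close>, so \<open>c\<close> is
    a cycle. This derives the chain map property of \<open>\<phi>\<close> from the homotopy equation
    on the faces.\<close>
  define u where "u = R.basis \<sigma> \<ominus>\<^sub>c e"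
  have u: "u \<in> R.chains UNIV" using eU by (simp add: u_def)
  have bu: "R.boundary u = c"
    using eU cU by (simp add: u_def R.boundary_diff be R.diff_diff_cancel)
  then have "R.boundary c = R.zero_chain" using u by (metis R.boundary_boundary)
  then obtain p where p: "p \<in> R.chains (tr (g <# L) D2 (Suc (Suc m)))" and bp: "R.boundary p = c"
    using fill c by (auto simp: R.inessential_def)
  note pU = R.chains_UNIV[OF p]
  define v where "v = u \<ominus>\<^sub>c p"
  have bv: "R.boundary v = R.zero_chain"
    using u pU cU by (simp add: v_def R.boundary_diff bu bp)
  let ?X = "tr {g} (D3 <#> L) (Suc (Suc m))"
  have "tr {g} (C <#> L) (Suc (Suc m)) \<subseteq> ?X"
    using D3 by (intro translates_mono mono_set_mult) auto
  then have \<sigma>': "\<sigma> \<in> ?X" using \<sigma> by blast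
  have "tr {g} (D <#> L) (Suc (Suc m)) \<subseteq> ?X"
    using D D3 by (intro translates_mono mono_set_mult) auto
  then have "e \<in> R.chains ?X" using e by (rule R.chains_mono[rotated])
  moreover have "p \<in> R.chains ?X"
    using p translates_l_coset_subset[OF P_carrier[OF g] D(3) D3(4)] by (rule R.chains_mono)
  ultimately have v: "v \<in> R.chains ?X"
    using \<sigma>' by (simp add: v_def u_def)
  \<comment> \<open>A vertex of \<sigma> serves as apex: it lies in g D3 L, so coning does not leave
    g.E(D3 L).\<close>
  obtain x where x: "x \<in> set \<sigma>" using translates_length[OF \<sigma>] by (cases \<sigma>) auto
  define q where "q = R.push (Cons x) v"
  have "q \<in> R.chains (tr {g} (D3 <#> L) (Suc (Suc (Suc m))))"
    unfolding q_def using v by (rule R.push_closed) (use x \<sigma>' in \<open>auto simp: translates_iff\<close>)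
  moreover have "R.boundary q = R.basis \<sigma> \<ominus>\<^sub>c p \<ominus>\<^sub>c e"
  proof -
    have "R.boundary q = v"
      unfolding q_def using R.chains_UNIV[OF v] by (simp add: R.boundary_cone bv)
    then show ?thesis
      using R.diff_right_commute[of "R.basis \<sigma>" e p] eU pU by (simp add: v_def u_def)
  qed
  ultimately show ?thesis using p unfolding e_def by blast
qed

lemma deformation_closed:
  assumes "deformation C m D \<phi> h"
  shows "\<phi> \<sigma> \<in> R.chains UNIV" "h \<sigma> \<in> R.chains UNIV" "h [] = R.zero_chain"
  using assms unfolding deformation_def by simp_all

lemma deformation_simplex:
  assumes "deformation C m D \<phi> h" "k \<le> m" "g \<in> P" "\<sigma> \<in> tr {g} (C <#> L) (Suc k)"
  shows "\<phi> \<sigma> \<in> R.chains (tr (g <# L) D (Suc k))"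
    and "h \<sigma> \<in> R.chains (tr {g} (D <#> L) (Suc (Suc k)))"
    and "R.boundary (h \<sigma>) = R.basis \<sigma> \<ominus>\<^sub>c \<phi> \<sigma> \<ominus>\<^sub>c R.lift h (R.bd \<sigma>)"
  using assms unfolding deformation_def by metis+

lemma deformation_relative:
  assumes "deformation C m D \<phi> h" "k \<le> m" "\<sigma> \<in> tr P C (Suc k)"
  shows "\<phi> \<sigma> = R.basis \<sigma>" "h \<sigma> = R.zero_chain"
  using assms unfolding deformation_def by metis+

text \<open>The values on a new simplex are built from one chosen translate containing it but must
  lie in the carriers of all of them. Passing from \<open>D3\<close> to \<open>D4\<close> by
  \<open>change_translate\<close> pays for this choice.\<close>

lemma deformation_Suc:
  assumes def: "deformation C m D \<phi> h" and C: "C \<in> K" and D: "D \<in> K" and m: "m < n"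
  shows "\<exists>D'\<in>K. \<exists>\<phi>' h'. deformation C (Suc m) D' \<phi>' h'"
proof -
  obtain D2 where D2: "D2 \<in> K" "D \<subseteq> D2"
    and fill: "\<And>g. g \<in> carrier G \<Longrightarrow> R.inessential (tr (g <# L) D (Suc m)) (tr (g <# L) D2 (Suc (Suc m)))"
    using fill_carrier[OF m D] by blast
  obtain D3' where D3': "D3' \<in> K" "L <#> D2 \<subseteq> D3' <#> L"
    using K_comm[OF D2(1)] by blast
  \<comment> \<open>Including \<open>C\<close> keeps \<sigma> itself in g.E(D3 L), and D3' absorbs
    \<open>L <#> D2\<close>, so \<sigma>, the old homotopy and the new filling share one full
    simplex.\<close>
  define D3 where "D3 = D3' \<union> D2 \<union> C"
  have "D3' <#> L \<subseteq> D3 <#> L" by (intro mono_set_mult) (auto simp: D3_def)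
  then have D3: "D3 \<in> K" "D2 \<subseteq> D3" "C \<subseteq> D3" "L <#> D2 \<subseteq> D3 <#> L"
    using D3' K_Un D2 C by (auto simp: D3_def)
  from change_translate[OF C D3(1)] obtain D4 where D4: "D4 \<in> K" "D3 \<subseteq> D4"
    and change: "\<forall>g\<in>carrier G. \<forall>g'\<in>carrier G. \<forall>x l. x \<in> g <# (C <#> L) \<and> x \<in> g' <# (C <#> L) \<longrightarrow>
     tr (g' <# L) D3 l \<subseteq> tr (g <# L) D4 l \<and> tr {g'} (D3 <#> L) l \<subseteq> tr {g} (D4 <#> L) l"
    by (elim bexE conjE) (rule that)
  have shared: "tr (g' <# L) D3 l \<subseteq> tr (g <# L) D4 l \<and> tr {g'} (D3 <#> L) l \<subseteq> tr {g} (D4 <#> L) l"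
    if "g \<in> P" "g' \<in> P" "\<sigma> \<in> tr {g} (C <#> L) (Suc k)" "\<sigma> \<in> tr {g'} (C <#> L) (Suc k)" for g g' \<sigma> k l
  proof -
    note prems = that
    obtain x where "x \<in> set \<sigma>" using translates_length[OF prems(3)] by (cases \<sigma>) auto
    then have "x \<in> g <# (C <#> L) \<and> x \<in> g' <# (C <#> L)"
      using prems(3,4) by (auto simp: translates_iff l_coset_def)
    then show ?thesis
      using change[rule_format, OF P_carrier[OF prems(1)] P_carrier[OF prems(2)]] by (intro conjI) simp_all
  qed
  let ?W = "\<lambda>g. tr {g} (C <#> L) (Suc (Suc m))"
  define N where "N \<sigma> \<longleftrightarrow> (\<exists>g\<in>P. \<sigma> \<in> ?W g)" for \<sigma>
  define Q where "Q \<sigma> g p q \<longleftrightarrow> g \<in> P \<and> \<sigma> \<in> ?W g \<and>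
    p \<in> R.chains (tr (g <# L) D2 (Suc (Suc m))) \<and>
    q \<in> R.chains (tr {g} (D3 <#> L) (Suc (Suc (Suc m)))) \<and>
    R.boundary q = R.basis \<sigma> \<ominus>\<^sub>c p \<ominus>\<^sub>c R.lift h (R.bd \<sigma>)" for \<sigma> g p q
  have "\<exists>g p q. Q \<sigma> g p q" if N: "N \<sigma>" for \<sigma>
  proof -
    obtain g where g: "g \<in> P" "\<sigma> \<in> ?W g" using N unfolding N_def by (rule bexE)
    show ?thesis
      using deformation_fill[OF def C D D2(2,1) D3 fill[OF P_carrier[OF g(1)]] g] g
      unfolding Q_def by (elim exE) (intro exI conjI; elim conjE; assumption)
  qed
  then obtain gg pp qq where *: "\<And>\<sigma>. N \<sigma> \<Longrightarrow> Q \<sigma> (gg \<sigma>) (pp \<sigma>) (qq \<sigma>)"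
    by metis
  let ?Y = "tr P C (Suc (Suc m))"
  \<comment> \<open>Only dimension m + 1 is new. There the simplices of P.E(C) are kept fixed, as
    the relative condition demands; the zero chain is a default for tuples outside P.E(C L).\<close>
  define \<phi>' where "\<phi>' \<sigma> = (if length \<sigma> \<noteq> Suc (Suc m) then \<phi> \<sigma> else if \<sigma> \<in> ?Y then R.basis \<sigma>
    else if N \<sigma> then pp \<sigma> else R.zero_chain)" for \<sigma>
  define h' where "h' \<sigma> = (if length \<sigma> \<noteq> Suc (Suc m) then h \<sigma> else if \<sigma> \<in> ?Y then R.zero_chain
    else if N \<sigma> then qq \<sigma> else R.zero_chain)" for \<sigma>
  note U = deformation_closed[OF def]
  have U': "\<phi>' \<sigma> \<in> R.chains UNIV" "h' \<sigma> \<in> R.chains UNIV" for \<sigma>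
  proof -
    have "pp \<sigma> \<in> R.chains UNIV" "qq \<sigma> \<in> R.chains UNIV" if "N \<sigma>"
      using *[OF that] unfolding Q_def by (blast intro: R.chains_UNIV)+
    then show "\<phi>' \<sigma> \<in> R.chains UNIV" "h' \<sigma> \<in> R.chains UNIV"
      unfolding \<phi>'_def h'_def using U by simp_all
  qed
  \<comment> \<open>Faces of these tuples have at most m + 1 entries, where \<open>h'\<close> is
    still \<open>h\<close>.\<close>
  have lift_h': "R.lift h' (R.bd \<sigma>) = R.lift h (R.bd \<sigma>)" if "length \<sigma> \<le> Suc (Suc m)" for \<sigma>
    by (rule R.lift_cong[OF R.bd_closed]) (use that U U' in \<open>auto simp: h'_def\<close>)
  have new: "\<phi>' \<sigma> \<in> R.chains (tr (g <# L) D4 (Suc k)) \<and>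
        h' \<sigma> \<in> R.chains (tr {g} (D4 <#> L) (Suc (Suc k))) \<and>
        R.boundary (h' \<sigma>) = R.basis \<sigma> \<ominus>\<^sub>c \<phi>' \<sigma> \<ominus>\<^sub>c R.lift h' (R.bd \<sigma>)"
    if k: "k \<le> Suc m" and g: "g \<in> P" and \<sigma>: "\<sigma> \<in> tr {g} (C <#> L) (Suc k)" for k g \<sigma>
  proof -
    have len: "length \<sigma> = Suc k" using \<sigma> by (rule translates_length)
    show ?thesis
    proof (cases "k = Suc m")
      case False
      then have old: "\<phi>' \<sigma> = \<phi> \<sigma>" "h' \<sigma> = h \<sigma>" using len by (auto simp: \<phi>'_def h'_def)
      have km: "k \<le> m" using k False by simp
      have "tr (g <# L) D (Suc k) \<subseteq> tr (g <# L) D4 (Suc k)"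
        using D2 D3 D4 by (intro translates_mono) auto
      moreover have "tr {g} (D <#> L) (Suc (Suc k)) \<subseteq> tr {g} (D4 <#> L) (Suc (Suc k))"
        using D2 D3 D4 by (intro translates_mono mono_set_mult) auto
      moreover have "R.lift h' (R.bd \<sigma>) = R.lift h (R.bd \<sigma>)"
        using len k by (intro lift_h') simp
      ultimately show ?thesis
        using deformation_simplex[OF def km g \<sigma>] unfolding old
        by (intro conjI) (simp_all add: R.chains_mono)
    next
      case True
      show ?thesis
      proof (cases "\<sigma> \<in> ?Y")
        case Y: True
        then have new_eq: "\<phi>' \<sigma> = R.basis \<sigma>" "h' \<sigma> = R.zero_chain"
          using len True by (auto simp: \<phi>'_def h'_def)
        \<comment> \<open>The fixed simplex lies in g'.E(C) for some g' that need not be the given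
          g; its carrier g' L.E(D3) is transferred to g. The homotopy equation holds because the
          faces of \<sigma> are again in P.E(C), where \<open>h\<close> vanishes.\<close>
        obtain g' where g': "g' \<in> P" "\<sigma> \<in> tr {g'} C (Suc k)"
          using Y True by (auto simp: translates_iff)
        have "tr {g'} C (Suc k) \<subseteq> tr {g'} (C <#> L) (Suc k)"
          by (intro translates_mono subset_set_mult_L K_sub[OF C]) auto
        then have "tr (g' <# L) D3 (Suc k) \<subseteq> tr (g <# L) D4 (Suc k)"
          using shared[OF g g'(1) \<sigma> subsetD[OF _ g'(2)]] by simp
        moreover have "tr {g'} C (Suc k) \<subseteq> tr (g' <# L) D3 (Suc k)"
          using D3 g' P_carrier G.lcos_self[OF _ subgroup_L] by (intro translates_mono) auto
        ultimately have "\<sigma> \<in> tr (g <# L) D4 (Suc k)" using g'(2) by (meson subsetD)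
        moreover have "R.lift h (R.bd \<sigma>) = R.zero_chain"
          using U deformation_relative(2)[OF def order_refl]
          by (intro R.lift_cong_zero[OF translates_faces[OF Y]])
        then have "R.lift h' (R.bd \<sigma>) = R.zero_chain"
          using lift_h'[of \<sigma>] len k by simp
        ultimately show ?thesis by (simp add: new_eq)
      next
        case False
        have ex: "N \<sigma>" unfolding N_def using g \<sigma> True by auto
        have new_eq: "\<phi>' \<sigma> = pp \<sigma>" "h' \<sigma> = qq \<sigma>"
          using len True False ex by (simp_all add: \<phi>'_def h'_def)
        note gg = *[OF ex, unfolded Q_def]
        have "\<sigma> \<in> tr {gg \<sigma>} (C <#> L) (Suc k)" using gg True by simp
        note ch = shared[OF g _ \<sigma> this]
        have ch: "tr (gg \<sigma> <# L) D3 l \<subseteq> tr (g <# L) D4 l \<and> tr {gg \<sigma>} (D3 <#> L) l \<subseteq> tr {g} (D4 <#> L) l" for l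
          using gg by (intro ch) simp
        have "tr (gg \<sigma> <# L) D2 l \<subseteq> tr (gg \<sigma> <# L) D3 l" for l
          using D3 by (intro translates_mono) auto
        then have "tr (gg \<sigma> <# L) D2 l \<subseteq> tr (g <# L) D4 l" for l
          using ch by (meson order_trans)
        then have "pp \<sigma> \<in> R.chains (tr (g <# L) D4 (Suc k))"
          using gg R.chains_mono unfolding True by metis
        moreover have "qq \<sigma> \<in> R.chains (tr {g} (D4 <#> L) (Suc (Suc k)))"
          using gg ch R.chains_mono unfolding True by metis
        ultimately show ?thesis
          using gg lift_h'[of \<sigma>] len k by (simp add: new_eq)
      qed
    qed
  qed
  have rel: "\<phi>' \<sigma> = R.basis \<sigma> \<and> h' \<sigma> = R.zero_chain"
    if k: "k \<le> Suc m" and \<sigma>: "\<sigma> \<in> tr P C (Suc k)" for k \<sigma>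
  proof (cases "k = Suc m")
    case True
    then show ?thesis using \<sigma> translates_length[OF \<sigma>] by (simp add: \<phi>'_def h'_def)
  next
    case False
    then show ?thesis
      using deformation_relative[OF def _ \<sigma>] k translates_length[OF \<sigma>] by (simp add: \<phi>'_def h'_def)
  qed
  have nil: "h' [] = R.zero_chain" using U by (simp add: h'_def)
  have "deformation C (Suc m) D4 \<phi>' h'"
    unfolding deformation_def
    by (intro conjI allI impI ballI; (rule U' nil new[THEN conjunct1] new[THEN conjunct2, THEN conjunct1]
          new[THEN conjunct2, THEN conjunct2] rel[THEN conjunct1] rel[THEN conjunct2]; assumption))
  then show ?thesis using D4 by blast
qed

lemma deformation_exists:
  assumes C: "C \<in> K" and "m \<le> n"
  shows "\<exists>D\<in>K. \<exists>\<phi> h. deformation C m D \<phi> h"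
  using assms(2)
proof (induction m)
  case 0
  then show ?case using deformation_0[OF C] by simp
next
  case (Suc m)
  then obtain D \<phi> h where "D \<in> K" "deformation C m D \<phi> h" by auto
  then show ?case using deformation_Suc[OF _ C] Suc.prems by simp
qed

text \<open>Take y = \<open>\<phi>\<close> z and w = \<open>h\<close> z. The homotopy equation gives
  the boundary of w as z - y - \<open>h\<close>(boundary of z), and the last term is zero since the
  boundary of z lives on P.E(C).\<close>

lemma relative_cycles_compress:
  assumes C: "C \<in> K" and m: "m \<le> n"
  shows "\<exists>D\<in>K. C \<subseteq> D \<and> (\<forall>z\<in>R.chains (tr P (C <#> L) (Suc m)). R.boundary z \<in> R.chains (tr P C m) \<longrightarrow>
    (\<exists>y\<in>R.chains (tr P D (Suc m)). \<exists>w\<in>R.chains (tr P (D <#> L) (Suc (Suc m))). R.boundary w = z \<ominus>\<^sub>c y))"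
proof -
  obtain D0 \<phi> h where D0: "D0 \<in> K" and def: "deformation C m D0 \<phi> h"
    using deformation_exists[OF assms] by blast
  note U = deformation_closed(1,2)[OF def]
  let ?D = "D0 \<union> C"
  \<comment> \<open>The vanishing of the character on \<open>L\<close> enters here, through
    \<open>L_sub_P\<close>: the carriers g L.E(D) stay inside P.E(D).\<close>
  have PL: "g <# L \<subseteq> P" if "g \<in> P" for g
    using that P_mult L_sub_P by (auto simp: l_coset_def)
  have "\<exists>y\<in>R.chains (tr P ?D (Suc m)). \<exists>w\<in>R.chains (tr P (?D <#> L) (Suc (Suc m))). R.boundary w = z \<ominus>\<^sub>c y"
    if z: "z \<in> R.chains (tr P (C <#> L) (Suc m))" and bz: "R.boundary z \<in> R.chains (tr P C m)" for z
  proof -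
    note zU = R.chains_UNIV[OF z]
    have \<sigma>: "\<phi> \<sigma> \<in> R.chains (tr P ?D (Suc m)) \<and> h \<sigma> \<in> R.chains (tr P (?D <#> L) (Suc (Suc m))) \<and>
        R.boundary (h \<sigma>) = R.basis \<sigma> \<ominus>\<^sub>c \<phi> \<sigma> \<ominus>\<^sub>c R.lift h (R.bd \<sigma>)"
      if "\<sigma> \<in> tr P (C <#> L) (Suc m)" for \<sigma>
    proof -
      obtain g where g: "g \<in> P" "\<sigma> \<in> tr {g} (C <#> L) (Suc m)"
        using \<open>\<sigma> \<in> _\<close> by (auto simp: translates_iff)
      have "tr (g <# L) D0 (Suc m) \<subseteq> tr P ?D (Suc m)"
        using PL g by (intro translates_mono) auto
      moreover have "tr {g} (D0 <#> L) (Suc (Suc m)) \<subseteq> tr P (?D <#> L) (Suc (Suc m))"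
        using g by (intro translates_mono mono_set_mult) auto
      ultimately show ?thesis
        using deformation_simplex[OF def order_refl g] by (intro conjI) (simp_all add: R.chains_mono)
    qed
    let ?y = "R.lift \<phi> z" and ?w = "R.lift h z"
    have y: "?y \<in> R.chains (tr P ?D (Suc m))" and w: "?w \<in> R.chains (tr P (?D <#> L) (Suc (Suc m)))"
      using \<sigma> U by (auto intro!: R.lift_closed[OF z])
    \<comment> \<open>For m = 0 the boundary is a multiple of the empty tuple, which is why a
      deformation includes the condition on \<open>h []\<close>.\<close>
    have hb: "R.lift h (R.boundary z) = R.zero_chain"
    proof (rule R.lift_cong_zero[OF bz _ U(2)])
      fix \<tau> assume \<tau>: "\<tau> \<in> tr P C m"
      show "h \<tau> = R.zero_chain"
      proof (cases m)
        case 0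
        then show ?thesis using translates_length[OF \<tau>] deformation_closed(3)[OF def] by simp
      next
        case (Suc m')
        then show ?thesis using deformation_relative(2)[OF def, of m' \<tau>] \<tau> by simp
      qed
    qed
    have "R.boundary ?w = R.lift (\<lambda>\<sigma>. R.basis \<sigma> \<ominus>\<^sub>c \<phi> \<sigma> \<ominus>\<^sub>c R.lift h (R.bd \<sigma>)) z"
      unfolding R.boundary_lift[OF zU U(2)]
      by (rule R.lift_cong[OF z]) (use U \<sigma> in auto)
    also have "\<dots> = z \<ominus>\<^sub>c ?y \<ominus>\<^sub>c R.lift (\<lambda>\<sigma>. R.lift h (R.bd \<sigma>)) z"
      using U zU by (simp add: R.lift_fun_diff)
    also have "R.lift (\<lambda>\<sigma>. R.lift h (R.bd \<sigma>)) z = R.lift h (R.boundary z)"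
      unfolding R.boundary_def by (rule R.lift_lift[symmetric]) (use U zU in auto)
    finally have "R.boundary ?w = z \<ominus>\<^sub>c ?y"
      using hb zU R.chains_UNIV[OF y] by simp
    then show ?thesis using y w by blast
  qed
  then show ?thesis using K_Un[OF D0 C] by (intro bexI[of _ ?D]) auto
qed

text \<open>A k-cycle of P.E(C) bounds some w in P.E(C1 L), and w is a relative cycle of dimension k
  + 1. Compressing w into P.E(D) preserves its boundary and costs one dimension: k + 1 \<le>
  n.\<close>

lemma group_filtration_acyclic:
  assumes k: "k < n"
    and W: "\<And>C. C \<in> K \<Longrightarrow> \<exists>D\<in>K. C \<subseteq> D \<and>
      R.inessential (tr P (C <#> L) (Suc k)) (tr P (D <#> L) (Suc (Suc k)))"
    and C: "C \<in> K"
  shows "\<exists>D\<in>K. C \<subseteq> D \<and> R.inessential (tr P C (Suc k)) (tr P D (Suc (Suc k)))"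
proof -
  obtain C1 where C1: "C1 \<in> K" "C \<subseteq> C1"
    and fill: "R.inessential (tr P (C <#> L) (Suc k)) (tr P (C1 <#> L) (Suc (Suc k)))"
    using W[OF C] by (elim bexE conjE) (rule that)
  have "Suc k \<le> n" using k by simp
  from relative_cycles_compress[OF C1(1) this] obtain D where D: "D \<in> K" "C1 \<subseteq> D"
    and compress: "\<forall>z\<in>R.chains (tr P (C1 <#> L) (Suc (Suc k))). R.boundary z \<in> R.chains (tr P C1 (Suc k)) \<longrightarrow>
    (\<exists>y\<in>R.chains (tr P D (Suc (Suc k))). \<exists>w\<in>R.chains (tr P (D <#> L) (Suc (Suc (Suc k)))). R.boundary w = z \<ominus>\<^sub>c y)"
    by (elim bexE conjE) (rule that)
  have "R.inessential (tr P C (Suc k)) (tr P D (Suc (Suc k)))"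
    unfolding R.inessential_def
  proof (intro ballI impI)
    fix z assume z: "z \<in> R.chains (tr P C (Suc k))" and bz: "R.boundary z = R.zero_chain"
    have "tr P C (Suc k) \<subseteq> tr P (C <#> L) (Suc k)"
      by (intro translates_mono subset_set_mult_L K_sub[OF C] order_refl)
    then have "z \<in> R.chains (tr P (C <#> L) (Suc k))" by (rule R.chains_mono[OF z])
    from R.inessentialD[OF fill this bz]
    obtain w where w: "w \<in> R.chains (tr P (C1 <#> L) (Suc (Suc k)))" and bw: "R.boundary w = z"
      by (rule bexE)
    have "R.boundary w \<in> R.chains (tr P C1 (Suc k))"
      unfolding bw using z translates_mono[OF order_refl C1(2)] by (rule R.chains_mono)
    from compress[rule_format, OF w this] obtain y v where y: "y \<in> R.chains (tr P D (Suc (Suc k)))"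
      and v: "v \<in> R.chains (tr P (D <#> L) (Suc (Suc (Suc k))))" and bv: "R.boundary v = w \<ominus>\<^sub>c y"
      by (elim bexE) (rule that)
    note U = R.chains_UNIV[OF w] R.chains_UNIV[OF y] R.chains_UNIV[OF v]
    have "R.boundary w \<ominus>\<^sub>c R.boundary y = R.boundary (R.boundary v)"
      using U by (simp add: bv R.boundary_diff)
    also have "\<dots> = R.zero_chain" by (rule R.boundary_boundary[OF U(3)])
    finally have "R.boundary w = R.boundary y"
      by (rule R.diff_chain_eq_zero[OF R.boundary_closed_UNIV[OF U(1)] R.boundary_closed_UNIV[OF U(2)]])
    then show "\<exists>w\<in>R.chains (tr P D (Suc (Suc k))). R.boundary w = z"
      unfolding bw[symmetric] using y by (intro bexI[of _ y]) simp_all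
  qed
  then show ?thesis using D C1 by (intro bexI[of _ D]) auto
qed

text \<open>Here the k-cycle itself is compressed into P.E(D) and then filled there by assumption,
  so k = n is still allowed.\<close>

lemma saturated_filtration_acyclic:
  assumes k: "k \<le> n"
    and Y: "\<And>C. C \<in> K \<Longrightarrow> \<exists>D\<in>K. C \<subseteq> D \<and> R.inessential (tr P C (Suc k)) (tr P D (Suc (Suc k)))"
    and C: "C \<in> K"
  shows "\<exists>D\<in>K. C \<subseteq> D \<and> R.inessential (tr P (C <#> L) (Suc k)) (tr P (D <#> L) (Suc (Suc k)))"
proof -
  from relative_cycles_compress[OF C k] obtain D where D: "D \<in> K" "C \<subseteq> D"
    and compress: "\<forall>z\<in>R.chains (tr P (C <#> L) (Suc k)). R.boundary z \<in> R.chains (tr P C k) \<longrightarrow>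
    (\<exists>y\<in>R.chains (tr P D (Suc k)). \<exists>w\<in>R.chains (tr P (D <#> L) (Suc (Suc k))). R.boundary w = z \<ominus>\<^sub>c y)"
    by (elim bexE conjE) (rule that)
  obtain D' where D': "D' \<in> K" "D \<subseteq> D'"
    and fill: "R.inessential (tr P D (Suc k)) (tr P D' (Suc (Suc k)))"
    using Y[OF D(1)] by (elim bexE conjE) (rule that)
  have "R.inessential (tr P (C <#> L) (Suc k)) (tr P (D' <#> L) (Suc (Suc k)))"
    unfolding R.inessential_def
  proof (intro ballI impI)
    fix z assume z: "z \<in> R.chains (tr P (C <#> L) (Suc k))" and bz: "R.boundary z = R.zero_chain"
    then have "R.boundary z \<in> R.chains (tr P C k)" by simp
    from compress[rule_format, OF z this] obtain y w where y: "y \<in> R.chains (tr P D (Suc k))"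
      and w: "w \<in> R.chains (tr P (D <#> L) (Suc (Suc k)))" and bw: "R.boundary w = z \<ominus>\<^sub>c y"
      by (elim bexE) (rule that)
    note U = R.chains_UNIV[OF z] R.chains_UNIV[OF y] R.chains_UNIV[OF w]
    have "R.boundary z \<ominus>\<^sub>c R.boundary y = R.boundary (R.boundary w)"
      using U by (simp add: bw R.boundary_diff)
    also have "\<dots> = R.zero_chain" by (rule R.boundary_boundary[OF U(3)])
    finally have "R.boundary z = R.boundary y"
      by (rule R.diff_chain_eq_zero[OF R.boundary_closed_UNIV[OF U(1)] R.boundary_closed_UNIV[OF U(2)]])
    then have "R.boundary y = R.zero_chain" using bz by simp
    from R.inessentialD[OF fill y this]
    obtain v where v: "v \<in> R.chains (tr P D' (Suc (Suc k)))" and bv: "R.boundary v = y"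
      by (rule bexE)
    let ?X = "tr P (D' <#> L) (Suc (Suc k))"
    have "w \<in> R.chains ?X"
      using w translates_mono[OF order_refl mono_set_mult[OF D'(2) order_refl]] by (rule R.chains_mono)
    moreover have "v \<in> R.chains ?X"
      using v translates_mono[OF order_refl subset_set_mult_L[OF K_sub[OF D'(1)]]] by (rule R.chains_mono)
    moreover have "R.boundary (w \<oplus>\<^sub>c v) = z"
      using U R.chains_UNIV[OF v] by (simp add: R.boundary_add bw bv R.diff_add_cancel)
    ultimately show "\<exists>w\<in>R.chains ?X. R.boundary w = z"
      by (intro bexI[of _ "w \<oplus>\<^sub>c v"]) auto
  qed
  then show ?thesis using D D' by (intro bexI[of _ D']) auto
qed

section \<open>Passage between the saturated filtration and the coset space\<close>

abbreviation coset :: "'g \<Rightarrow> 'g set" where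
  "coset x \<equiv> x <# L"

abbreviation trq :: "'g set \<Rightarrow> 'g set set \<Rightarrow> nat \<Rightarrow> 'g set list set" where
  "trq \<equiv> translates (\<lambda>g x. g <# x)"

definition representative :: "'g set \<Rightarrow> 'g" where
  "representative X = (SOME x. x \<in> X)"

lemma coset_mult:
  assumes "g \<in> carrier G" "c \<in> carrier G" "l \<in> L"
  shows "coset (g \<otimes> (c \<otimes> l)) = g <# coset c"
proof -
  have "coset (g \<otimes> (c \<otimes> l)) = g <# (c <# (l <# L))"
    using assms L_carrier[OF assms(3)] L_sub by (simp add: G.lcos_m_assoc)
  also have "l <# L = L"
    using assms(3) L_carrier[OF assms(3)] subgroup_L by (simp add: G.coset_join3)
  finally show ?thesis .
qed

lemma representative_in:
  assumes "g \<in> carrier G" "c \<in> carrier G"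
  shows "\<exists>l\<in>L. representative (g <# coset c) = g \<otimes> (c \<otimes> l)"
proof -
  have "g \<otimes> (c \<otimes> \<one>) \<in> g <# coset c"
    unfolding l_coset_def using L_closed(3) by blast
  then have "representative (g <# coset c) \<in> g <# coset c"
    unfolding representative_def by (rule someI)
  then show ?thesis by (auto simp: l_coset_def)
qed

lemma map_coset:
  assumes C: "C \<in> K" and xs: "xs \<in> tr P (C <#> L) m"
  shows "map coset xs \<in> trq P (coset ` C) m"
proof -
  obtain g where g: "g \<in> P" "length xs = m" "set xs \<subseteq> (\<lambda>x. g \<otimes> x) ` (C <#> L)"
    using xs by (auto simp: translates_iff)
  have "coset x \<in> (\<lambda>x. g <# x) ` (coset ` C)" if x: "x \<in> set xs" for x
  proof -
    obtain y where "x = g \<otimes> y" "y \<in> C <#> L" using g(3) x by blast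
    then obtain c l where cl: "c \<in> C" "l \<in> L" "x = g \<otimes> (c \<otimes> l)"
      by (auto simp: set_mult_def)
    have "coset x = g <# coset c"
      unfolding cl(3) using g(1) P_carrier K_carrier[OF C cl(1)] cl(2) by (intro coset_mult)
    then show ?thesis using imageI[OF imageI[OF cl(1)], of "\<lambda>x. g <# x" coset] by simp
  qed
  then have "set (map coset xs) \<subseteq> (\<lambda>x. g <# x) ` (coset ` C)"
    unfolding set_map by (rule image_subsetI)
  moreover have "length (map coset xs) = m" using g(2) by simp
  ultimately show ?thesis unfolding translates_iff using g(1) by (intro conjI bexI)
qed

text \<open>The whole coset g c L is contained in g C L. So any choice of representatives,
  equivariant or not, respects each single translate.\<close>

lemma representative_translate:
  assumes C: "C \<in> K" and g: "g \<in> P" and X: "X \<in> (\<lambda>x. g <# x) ` (coset ` C)"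
  shows "representative X \<in> (\<lambda>x. g \<otimes> x) ` (C <#> L)" "coset (representative X) = X"
proof -
  obtain c where c: "c \<in> C" "X = g <# coset c" using X by blast
  note car = P_carrier[OF g] K_carrier[OF C c(1)]
  obtain l where l: "l \<in> L" "representative X = g \<otimes> (c \<otimes> l)"
    using representative_in[OF car] c(2) by auto
  show "representative X \<in> (\<lambda>x. g \<otimes> x) ` (C <#> L)"
    unfolding l(2) using set_multI[OF c(1) l(1)] by (rule imageI)
  have "coset (representative X) = g <# coset c"
    unfolding l(2) by (rule coset_mult[OF car l(1)])
  then show "coset (representative X) = X" using c(2) by simp
qed

lemma map_representative:
  assumes C: "C \<in> K" and ys: "ys \<in> trq P (coset ` C) m"
  shows "map representative ys \<in> tr P (C <#> L) m" "map coset (map representative ys) = ys"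
proof -
  obtain g where g: "g \<in> P" "length ys = m" "set ys \<subseteq> (\<lambda>x. g <# x) ` (coset ` C)"
    using ys by (auto simp: translates_iff)
  have "set (map representative ys) \<subseteq> (\<lambda>x. g \<otimes> x) ` (C <#> L)"
    unfolding set_map by (intro image_subsetI representative_translate(1)[OF C g(1)] subsetD[OF g(3)])
  moreover have "length (map representative ys) = m" using g(2) by simp
  ultimately show "map representative ys \<in> tr P (C <#> L) m"
    unfolding translates_iff using g(1) by (intro conjI bexI)
  have "coset (representative X) = X" if X: "X \<in> set ys" for X
    by (rule representative_translate(2)[OF C g(1) subsetD[OF g(3) X]])
  then show "map coset (map representative ys) = ys"
    by (simp add: map_idI)
qed

text \<open>Representatives give a section of the projection: a cycle is lifted, filled upstairs,
  and the filling projected.\<close>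

lemma coset_filtration_acyclic:
  assumes W: "\<And>C. C \<in> K \<Longrightarrow> \<exists>D\<in>K. C \<subseteq> D \<and>
      R.inessential (tr P (C <#> L) (Suc k)) (tr P (D <#> L) (Suc (Suc k)))"
    and C: "C \<in> K"
  shows "\<exists>D\<in>K. C \<subseteq> D \<and>
      R.inessential (trq P (coset ` C) (Suc k)) (trq P (coset ` D) (Suc (Suc k)))"
proof -
  obtain D where D: "D \<in> K" "C \<subseteq> D"
    and fill: "R.inessential (tr P (C <#> L) (Suc k)) (tr P (D <#> L) (Suc (Suc k)))"
    using W[OF C] by (elim bexE conjE) (rule that)
  have "R.inessential (trq P (coset ` C) (Suc k)) (trq P (coset ` D) (Suc (Suc k)))"
    unfolding R.inessential_def
  proof (intro ballI impI)
    fix z assume z: "z \<in> R.chains (trq P (coset ` C) (Suc k))" and bz: "R.boundary z = R.zero_chain"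
    note zU = R.chains_UNIV[OF z]
    let ?z = "R.push (map representative) z"
    have "?z \<in> R.chains (tr P (C <#> L) (Suc k))"
      using z map_representative(1)[OF C] by (rule R.push_closed)
    moreover have "R.boundary ?z = R.zero_chain"
      by (simp add: R.boundary_push_map[OF zU] bz)
    ultimately have "\<exists>w\<in>R.chains (tr P (D <#> L) (Suc (Suc k))). R.boundary w = ?z"
      by (rule R.inessentialD[OF fill])
    then obtain w where w: "w \<in> R.chains (tr P (D <#> L) (Suc (Suc k)))" and bw: "R.boundary w = ?z"
      by (rule bexE)
    have "R.boundary (R.push (map coset) w) = R.push (map coset) ?z"
      by (simp add: R.boundary_push_map[OF R.chains_UNIV[OF w]] bw)
    also have "\<dots> = z"
      unfolding R.push_push[OF zU] using z map_representative(2)[OF C] by (rule R.push_id)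
    finally have "R.boundary (R.push (map coset) w) = z" .
    moreover have "R.push (map coset) w \<in> R.chains (trq P (coset ` D) (Suc (Suc k)))"
      using w map_coset[OF D(1)] by (rule R.push_closed)
    ultimately show "\<exists>w\<in>R.chains (trq P (coset ` D) (Suc (Suc k))). R.boundary w = z"
      by (rule bexI)
  qed
  then show ?thesis using D by (intro bexI[of _ D]) auto
qed

text \<open>Projecting and lifting back replaces each x by another point of the coset x L. As g C L
  is saturated, the prism joining this map to the identity stays in the translate of the given
  simplex.\<close>

lemma saturated_filtration_acyclic_if_coset:
  assumes Z: "\<And>C. C \<in> K \<Longrightarrow> \<exists>D\<in>K. R.inessential (trq P (coset ` C) (Suc k)) (trq P (coset ` D) (Suc (Suc k)))"
    and C: "C \<in> K"
  shows "\<exists>D\<in>K. C \<subseteq> D \<and> R.inessential (tr P (C <#> L) (Suc k)) (tr P (D <#> L) (Suc (Suc k)))"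
proof -
  obtain C' where C': "C' \<in> K"
    and fill: "R.inessential (trq P (coset ` C) (Suc k)) (trq P (coset ` C') (Suc (Suc k)))"
    using Z[OF C] by (elim bexE conjE) (rule that)
  \<comment> \<open>The hypothesis does not place \<open>C\<close> inside C', so \<open>C\<close> is
    added for the prism and for the required inclusion.\<close>
  let ?D = "C \<union> C'" and ?r = "\<lambda>x. representative (coset x)"
  let ?X = "tr P (?D <#> L) (Suc (Suc k))"
  have "R.inessential (tr P (C <#> L) (Suc k)) ?X"
    unfolding R.inessential_def
  proof (intro ballI impI)
    fix z assume z: "z \<in> R.chains (tr P (C <#> L) (Suc k))" and bz: "R.boundary z = R.zero_chain"
    note zU = R.chains_UNIV[OF z]
    let ?z = "R.push (map coset) z"
    have "?z \<in> R.chains (trq P (coset ` C) (Suc k))"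
      using z map_coset[OF C] by (rule R.push_closed)
    moreover have "R.boundary ?z = R.zero_chain"
      by (simp add: R.boundary_push_map[OF zU] bz)
    ultimately have "\<exists>w\<in>R.chains (trq P (coset ` C') (Suc (Suc k))). R.boundary w = ?z"
      by (rule R.inessentialD[OF fill])
    then obtain w where w: "w \<in> R.chains (trq P (coset ` C') (Suc (Suc k)))" and bw: "R.boundary w = ?z"
      by (rule bexE)
    let ?w = "R.push (map representative) w" and ?H = "R.lift (R.prism ?r (\<lambda>x. x)) z"
    have "R.boundary ?w = R.push (map representative) ?z"
      by (simp add: R.boundary_push_map[OF R.chains_UNIV[OF w]] bw)
    also have "\<dots> = R.push (map ?r) z"
      unfolding R.push_push[OF zU] by (simp add: comp_def)
    finally have bw': "R.boundary ?w = R.push (map ?r) z" .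
    have "?w \<in> R.chains (tr P (C' <#> L) (Suc (Suc k)))"
      using w map_representative(1)[OF C'] by (rule R.push_closed)
    then have w': "?w \<in> R.chains ?X"
      by (rule R.chains_mono) (intro translates_mono mono_set_mult; simp)
    have bH: "R.boundary ?H = z \<ominus>\<^sub>c R.push (map ?r) z"
      using R.prism_homotopy[OF zU bz, of ?r "\<lambda>x. x"] R.push_id[OF z, of "map (\<lambda>x. x)"] by simp
    have H: "?H \<in> R.chains ?X"
    proof (rule R.lift_closed[OF z])
      fix xs assume xs: "xs \<in> tr P (C <#> L) (Suc k)"
      then obtain g where g: "g \<in> P" "length xs = Suc k" "set xs \<subseteq> (\<lambda>x. g \<otimes> x) ` (C <#> L)"
        by (auto simp: translates_iff)
      have "set xs \<subseteq> (\<lambda>x. g \<otimes> x) ` (?D <#> L)"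
        by (rule order_trans[OF g(3) image_mono[OF mono_set_mult]]) auto
      moreover have "?r x \<in> (\<lambda>x. g \<otimes> x) ` (?D <#> L)" if x: "x \<in> set xs" for x
      proof -
        obtain y where "x = g \<otimes> y" "y \<in> C <#> L" using g(3) x by blast
        then obtain c l where cl: "c \<in> C" "l \<in> L" "x = g \<otimes> (c \<otimes> l)"
          by (auto simp: set_mult_def)
        have "coset x = g <# coset c"
          unfolding cl(3) using g(1) P_carrier K_carrier[OF C cl(1)] cl(2) by (intro coset_mult)
        then have "?r x \<in> (\<lambda>x. g \<otimes> x) ` (C <#> L)"
          using cl(1) by (intro representative_translate(1)[OF C g(1)]) simp
        moreover have "(\<lambda>x. g \<otimes> x) ` (C <#> L) \<subseteq> (\<lambda>x. g \<otimes> x) ` (?D <#> L)"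
          by (intro image_mono mono_set_mult) auto
        ultimately show ?thesis by (rule subsetD[rotated])
      qed
      ultimately have sub: "?r ` set xs \<union> (\<lambda>x. x) ` set xs \<subseteq> (\<lambda>x. g \<otimes> x) ` (?D <#> L)"
        unfolding image_ident by (intro Un_least image_subsetI)
      have "ys \<in> ?X" if ys: "set ys \<subseteq> ?r ` set xs \<union> (\<lambda>x. x) ` set xs \<and> length ys = Suc (length xs)" for ys
      proof -
        have "set ys \<subseteq> (\<lambda>x. g \<otimes> x) ` (?D <#> L)" using ys sub by (meson order_trans)
        then show ?thesis unfolding translates_iff using ys g(1,2) by (intro conjI bexI[of _ g]) simp_all
      qed
      then show "R.prism ?r (\<lambda>x. x) xs \<in> R.chains ?X"
        by (intro R.chains_mono[OF R.prism_closed] subsetI) (simp only: mem_Collect_eq)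
    qed simp
    have "R.boundary (?H \<oplus>\<^sub>c ?w) = z"
      using zU R.chains_UNIV[OF H] R.chains_UNIV[OF w'] by (simp add: R.boundary_add bH bw' R.diff_add_cancel)
    then show "\<exists>w\<in>R.chains ?X. R.boundary w = z"
      using H w' by (intro bexI[of _ "?H \<oplus>\<^sub>c ?w"]) auto
  qed
  then show ?thesis using K_Un[OF C C'] by (intro bexI[of _ ?D]) auto
qed

end

section \<open>Compact sets of groups and coset spaces\<close>

lemma compactin_set_mult:
  assumes "topological_group G T" "compactin T C" "compactin T D"
  shows "compactin T (C <#>\<^bsub>G\<^esub> D)"
proof -
  have "compactin (prod_topology T T) (C \<times> D)"
    using assms(2,3) by (simp add: compactin_Times)
  then have "compactin T ((\<lambda>(x, y). x \<otimes>\<^bsub>G\<^esub> y) ` (C \<times> D))"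
    using assms(1) by (intro image_compactin) (auto simp: topological_group_def)
  moreover have "(\<lambda>(x, y). x \<otimes>\<^bsub>G\<^esub> y) ` (C \<times> D) = C <#>\<^bsub>G\<^esub> D"
    by (auto simp: set_mult_def)
  ultimately show ?thesis by simp
qed

lemma compactin_m_inv:
  "topological_group G T \<Longrightarrow> compactin T C \<Longrightarrow> compactin T (m_inv G ` C)"
  by (rule image_compactin) (auto simp: topological_group_def)

lemma compactin_coset_image:
  "compactin T C \<Longrightarrow> compactin (left_coset_topology G T L) ((\<lambda>x. x <#\<^bsub>G\<^esub> L) ` C)"
  unfolding left_coset_topology_def
  by (rule image_compactin[OF _ quotient_imp_continuous_map[OF quotient_map_quotient_topology]])

text \<open>The saturation of U is the union of its right translates by \<open>L\<close>, each open
  as a preimage under a right multiplication.\<close>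

lemma openin_coset_image:
  assumes TG: "topological_group G T" and L: "subgroup L G" and U: "openin T U"
  shows "openin (left_coset_topology G T L) ((\<lambda>x. x <#\<^bsub>G\<^esub> L) ` U)"
proof -
  interpret group G using TG by (simp add: topological_group_def)
  have car: "topspace T = carrier G" using TG by (simp add: topological_group_def)
  have UG: "U \<subseteq> carrier G" using openin_subset[OF U] car by simp
  have LG: "L \<subseteq> carrier G" using L by (rule subgroup.subset)
  let ?V = "{x \<in> topspace T. x <#\<^bsub>G\<^esub> L \<in> (\<lambda>x. x <#\<^bsub>G\<^esub> L) ` U}"
  have "?V = (\<Union>l\<in>L. {x \<in> topspace T. x \<otimes>\<^bsub>G\<^esub> l \<in> U})" (is "_ = ?W")
  proof (intro equalityI subsetI)
    fix x assume "x \<in> ?V"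
    then obtain u where u: "x \<in> carrier G" "u \<in> U" "x <#\<^bsub>G\<^esub> L = u <#\<^bsub>G\<^esub> L"
      by (auto simp: car)
    have "u \<in> x <#\<^bsub>G\<^esub> L" using lcos_self[OF _ L] u UG by auto
    then show "x \<in> ?W" using u by (auto simp: car l_coset_def)
  next
    fix x assume "x \<in> ?W"
    then obtain l where l: "l \<in> L" "x \<in> carrier G" "x \<otimes>\<^bsub>G\<^esub> l \<in> U" by (auto simp: car)
    have "(x \<otimes>\<^bsub>G\<^esub> l) <#\<^bsub>G\<^esub> L = x <#\<^bsub>G\<^esub> (l <#\<^bsub>G\<^esub> L)"
      using l LG by (intro lcos_m_assoc[symmetric]) auto
    also have "l <#\<^bsub>G\<^esub> L = L"
      using l LG L by (intro coset_join3) auto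
    finally show "x \<in> ?V" using l by (auto simp: car intro!: image_eqI[of _ _ "x \<otimes>\<^bsub>G\<^esub> l"])
  qed
  moreover have "openin T {x \<in> topspace T. x \<otimes>\<^bsub>G\<^esub> l \<in> U}" if l: "l \<in> L" for l
  proof (rule openin_continuous_map_preimage[OF _ U])
    have "continuous_map T (prod_topology T T) (\<lambda>x. (x, l))"
      using l LG by (intro continuous_map_pairedI) (auto simp: car)
    moreover have "continuous_map (prod_topology T T) T (\<lambda>(x, y). x \<otimes>\<^bsub>G\<^esub> y)"
      using TG by (simp add: topological_group_def)
    ultimately show "continuous_map T T (\<lambda>x. x \<otimes>\<^bsub>G\<^esub> l)"
      by (auto dest: continuous_map_compose simp: comp_def)
  qed
  ultimately have "openin T ?V" by (auto intro: openin_Union)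
  then show ?thesis
    using openin_subset[OF U] by (auto simp: left_coset_topology_def openin_quotient_topology)
qed

text \<open>By local compactness, images of open sets with compact neighbourhoods cover the coset
  space, and finitely many cover F. Together with continuity of the projection this makes images of
  compact sets cofinal among the compact subsets of the coset space.\<close>

lemma compactin_coset_lift:
  assumes LC: "locally_compact_Hausdorff_group G T" and L: "subgroup L G"
    and F: "compactin (left_coset_topology G T L) F"
  shows "\<exists>C. compactin T C \<and> F \<subseteq> (\<lambda>x. x <#\<^bsub>G\<^esub> L) ` C"
proof -
  let ?Q = "left_coset_topology G T L" and ?q = "\<lambda>x. x <#\<^bsub>G\<^esub> L"
  have TG: "topological_group G T" and lc: "locally_compact_space T"
    using LC by (auto simp: locally_compact_Hausdorff_group_def)
  let ?U = "{V. openin ?Q V \<and> (\<exists>C. compactin T C \<and> V \<subseteq> ?q ` C)}"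
  have "F \<subseteq> \<Union>?U"
  proof
    fix X assume "X \<in> F"
    then have "X \<in> topspace ?Q" using F by (auto simp: compactin_def)
    then obtain x where x: "x \<in> topspace T" "X = ?q x"
      by (auto simp: left_coset_topology_def topspace_quotient_topology)
    obtain U C where U: "openin T U" "compactin T C" "x \<in> U" "U \<subseteq> C"
      using lc x(1) unfolding locally_compact_space_def by blast
    then have "?q ` U \<in> ?U" using openin_coset_image[OF TG L U(1)] by blast
    then show "X \<in> \<Union>?U" using x U(3) by blast
  qed
  then obtain \<F> where \<F>: "finite \<F>" "\<F> \<subseteq> ?U" "F \<subseteq> \<Union>\<F>"
    using F unfolding compactin_def by (metis (no_types, lifting) mem_Collect_eq)
  then have "\<forall>V\<in>\<F>. \<exists>C. compactin T C \<and> V \<subseteq> ?q ` C" by blast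
  then obtain c where c: "\<And>V. V \<in> \<F> \<Longrightarrow> compactin T (c V) \<and> V \<subseteq> ?q ` c V" by metis
  have "compactin T (\<Union>(c ` \<F>))"
    using \<F>(1) c by (intro compactin_Union) auto
  moreover have "F \<subseteq> ?q ` \<Union>(c ` \<F>)" using \<F>(3) c by blast
  ultimately show ?thesis by blast
qed

section \<open>The half-space monoid and the final assembly\<close>

lemma char_halfspace_mult:
  assumes "group G" "character G T chi" "g \<in> char_halfspace G chi" "h \<in> char_halfspace G chi"
  shows "g \<otimes>\<^bsub>G\<^esub> h \<in> char_halfspace G chi"
proof -
  interpret group G by fact
  have "chi (g \<otimes>\<^bsub>G\<^esub> h) = chi g + chi h"
    using assms(2-) by (auto simp: character_def hom_def real_add_group_def char_halfspace_def)
  then show ?thesis using assms(3,4) by (auto simp: char_halfspace_def)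
qed

theorem proposition5p6:
  fixes \<Gamma> :: "('g, 'm) monoid_scheme" and T :: "'g topology" and \<Lambda> :: "'g set"
    and R :: "('r, 'p) ring_scheme" and n :: nat and chi :: "'g \<Rightarrow> real"
  assumes "locally_compact_Hausdorff_group \<Gamma> T"
    and "subgroup \<Lambda> \<Gamma>" and "closedin T \<Lambda>"
    and "almost_commutes_with_compacts \<Gamma> T \<Lambda>"
    and "cring R"
    and "character \<Gamma> T chi" and "\<forall>x\<in>\<Lambda>. chi x = 0"
    and "type_CP R n (\<Gamma>\<lparr>carrier := \<Lambda>\<rparr>) (subtopology T \<Lambda>)"
  shows "(\<forall>k\<le>n.
            essentially_acyclic R (int k - 1) (compact_subsets (left_coset_topology \<Gamma> T \<Lambda>)) (\<subseteq>)
              (\<lambda>F. translates_E (\<lambda>g x. g <#\<^bsub>\<Gamma>\<^esub> x) (char_halfspace \<Gamma> chi) F)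
            \<longrightarrow> chi \<in> Sigma_top R k \<Gamma> T) \<and>
         (\<forall>k\<le>n + 1. chi \<in> Sigma_top R k \<Gamma> T \<longrightarrow>
            essentially_acyclic R (int k - 1) (compact_subsets (left_coset_topology \<Gamma> T \<Lambda>)) (\<subseteq>)
              (\<lambda>F. translates_E (\<lambda>g x. g <#\<^bsub>\<Gamma>\<^esub> x) (char_halfspace \<Gamma> chi) F))"
proof -
  let ?P = "char_halfspace \<Gamma> chi"
  have TG: "topological_group \<Gamma> T" using assms(1) by (simp add: locally_compact_Hausdorff_group_def)
  interpret \<Gamma>: group \<Gamma> using TG by (simp add: topological_group_def)
  interpret R: cring_chains R using assms(5) by (rule cring_chains.intro)
  have car: "topspace T = carrier \<Gamma>" using TG by (simp add: topological_group_def)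
  \<comment> \<open>The bound is an integer, so m = 0 gives degree -1 and an empty condition;
    otherwise the degrees tested are those below m.\<close>
  have acyclic_iff: "essentially_acyclic R (int m - 1) A (\<subseteq>) (translates_E act S) \<longleftrightarrow>
      (\<forall>k<m. \<forall>C\<in>A. \<exists>D\<in>A. C \<subseteq> D \<and>
        R.inessential (translates act S C (Suc k)) (translates act S D (Suc (Suc k))))"
    for m A and act :: "'a \<Rightarrow> 'x \<Rightarrow> 'x" and S
  proof -
    have "int k \<le> int m - 1 \<longleftrightarrow> k < m" for k by linarith
    then show ?thesis unfolding R.essentially_acyclic_translates_iff by simp
  qed
  have CP: "\<forall>k<n. \<forall>C\<in>compact_subsets (subtopology T \<Lambda>). \<exists>D\<in>compact_subsets (subtopology T \<Lambda>). C \<subseteq> D \<and>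
      R.inessential (translates (\<lambda>g x. g \<otimes>\<^bsub>\<Gamma>\<^esub> x) \<Lambda> C (Suc k)) (translates (\<lambda>g x. g \<otimes>\<^bsub>\<Gamma>\<^esub> x) \<Lambda> D (Suc (Suc k)))"
    using assms(8) unfolding type_CP_def acyclic_iff by simp
  interpret coset_filtration R \<Gamma> \<Lambda> ?P "compact_subsets T" n
  proof (intro coset_filtration.intro coset_filtration_axioms.intro R.cring_chains_axioms \<Gamma>.is_group)
    show "subgroup \<Lambda> \<Gamma>" by fact
    show "?P \<subseteq> carrier \<Gamma>" by (auto simp: char_halfspace_def)
    show "g \<otimes>\<^bsub>\<Gamma>\<^esub> h \<in> ?P" if "g \<in> ?P" "h \<in> ?P" for g h
      using char_halfspace_mult[OF \<Gamma>.is_group assms(6) that] .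
    show "\<Lambda> \<subseteq> ?P"
      using assms(7) subgroup.subset[OF assms(2)] by (auto simp: char_halfspace_def)
    show "\<exists>C'\<in>compact_subsets T. C <#>\<^bsub>\<Gamma>\<^esub> \<Lambda> \<subseteq> \<Lambda> <#>\<^bsub>\<Gamma>\<^esub> C' \<and> \<Lambda> <#>\<^bsub>\<Gamma>\<^esub> C \<subseteq> C' <#>\<^bsub>\<Gamma>\<^esub> \<Lambda>"
      if "C \<in> compact_subsets T" for C
      using assms(4) that unfolding almost_commutes_with_compacts_def compact_subsets_def by simp
    show "\<exists>D\<in>compact_subsets T. D \<subseteq> \<Lambda> \<and> C \<subseteq> D \<and>
      R.inessential (translates (\<lambda>g x. g \<otimes>\<^bsub>\<Gamma>\<^esub> x) \<Lambda> C (Suc k)) (translates (\<lambda>g x. g \<otimes>\<^bsub>\<Gamma>\<^esub> x) \<Lambda> D (Suc (Suc k)))"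
      if k: "k < n" and C: "C \<in> compact_subsets T" "C \<subseteq> \<Lambda>" for k C
    proof -
      \<comment> \<open>Compactness in the subspace is compactness in the group together with
        containment in the subgroup, which matches the two forms of the finiteness
        hypothesis.\<close>
      have "C \<in> compact_subsets (subtopology T \<Lambda>)"
        using C by (simp add: compact_subsets_def compactin_subtopology)
      from CP[rule_format, OF k this] obtain D where D: "D \<in> compact_subsets (subtopology T \<Lambda>)" "C \<subseteq> D"
        "R.inessential (translates (\<lambda>g x. g \<otimes>\<^bsub>\<Gamma>\<^esub> x) \<Lambda> C (Suc k)) (translates (\<lambda>g x. g \<otimes>\<^bsub>\<Gamma>\<^esub> x) \<Lambda> D (Suc (Suc k)))"
        by (elim bexE conjE) (rule that)
      then show ?thesis
        by (intro bexI[of _ D]) (auto simp: compact_subsets_def compactin_subtopology)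
    qed
  next
    fix C D assume C: "C \<in> compact_subsets T"
    show "C \<subseteq> carrier \<Gamma>" using C car by (auto simp: compact_subsets_def compactin_def)
    show "m_inv \<Gamma> ` C \<in> compact_subsets T"
      using C compactin_m_inv[OF TG] by (simp add: compact_subsets_def)
    show "C \<inter> \<Lambda> \<in> compact_subsets T"
      using C assms(3) by (simp add: compact_subsets_def compact_Int_closedin)
    assume D: "D \<in> compact_subsets T"
    show "C \<union> D \<in> compact_subsets T" using C D by (simp add: compact_subsets_def compactin_Un)
    show "C <#>\<^bsub>\<Gamma>\<^esub> D \<in> compact_subsets T"
      using C D compactin_set_mult[OF TG] by (simp add: compact_subsets_def)
  qed
  let ?KF = "compact_subsets (left_coset_topology \<Gamma> T \<Lambda>)"
  have KF: "coset ` C \<in> ?KF" if "C \<in> compact_subsets T" for C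
    using that compactin_coset_image by (auto simp: compact_subsets_def)
  \<comment> \<open>Cofinality: the filtration of the coset space may be tested on images of compact
    subsets of the group.\<close>
  have lift: "\<exists>C\<in>compact_subsets T. F \<subseteq> coset ` C" if "F \<in> ?KF" for F
    using that compactin_coset_lift[OF assms(1,2)] by (auto simp: compact_subsets_def)
  have Sigma: "chi \<in> Sigma_top R m \<Gamma> T \<longleftrightarrow> (\<forall>k<m. \<forall>C\<in>compact_subsets T. \<exists>D\<in>compact_subsets T. C \<subseteq> D \<and>
        R.inessential (tr ?P C (Suc k)) (tr ?P D (Suc (Suc k))))" for m
    using assms(6) unfolding Sigma_top_def acyclic_iff by simp
  show ?thesis
    unfolding Sigma unfolding acyclic_iff
  proof (intro conjI allI impI ballI)
    fix m k C
    assume m: "m \<le> n" and k: "k < m" and C: "C \<in> compact_subsets T"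
      and Z: "\<forall>k<m. \<forall>F\<in>?KF. \<exists>F'\<in>?KF. F \<subseteq> F' \<and> R.inessential (trq ?P F (Suc k)) (trq ?P F' (Suc (Suc k)))"
    have "\<exists>D\<in>compact_subsets T. R.inessential (trq ?P (coset ` C) (Suc k)) (trq ?P (coset ` D) (Suc (Suc k)))"
      if C: "C \<in> compact_subsets T" for C
    proof -
      from Z[rule_format, OF k KF[OF C]] obtain F' where F': "F' \<in> ?KF"
        "R.inessential (trq ?P (coset ` C) (Suc k)) (trq ?P F' (Suc (Suc k)))"
        by (elim bexE conjE) (rule that)
      obtain D where D: "D \<in> compact_subsets T" "F' \<subseteq> coset ` D" using lift[OF F'(1)] by (rule bexE)
      have "R.inessential (trq ?P (coset ` C) (Suc k)) (trq ?P (coset ` D) (Suc (Suc k)))"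
        by (rule R.inessential_mono[OF F'(2) order_refl translates_mono[OF order_refl D(2)]])
      then show ?thesis using D(1) by (rule bexI)
    qed
    then have "\<exists>D\<in>compact_subsets T. C \<subseteq> D \<and>
        R.inessential (tr ?P (C <#>\<^bsub>\<Gamma>\<^esub> \<Lambda>) (Suc k)) (tr ?P (D <#>\<^bsub>\<Gamma>\<^esub> \<Lambda>) (Suc (Suc k)))"
      if "C \<in> compact_subsets T" for C
      using that by (rule saturated_filtration_acyclic_if_coset)
    then show "\<exists>D\<in>compact_subsets T. C \<subseteq> D \<and> R.inessential (tr ?P C (Suc k)) (tr ?P D (Suc (Suc k)))"
      using C by (rule group_filtration_acyclic[OF less_le_trans[OF k m]])
  next
    fix m k F
    assume m: "m \<le> n + 1" and k: "k < m" and F: "F \<in> ?KF"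
      and Y: "\<forall>k<m. \<forall>C\<in>compact_subsets T. \<exists>D\<in>compact_subsets T. C \<subseteq> D \<and>
        R.inessential (tr ?P C (Suc k)) (tr ?P D (Suc (Suc k)))"
    \<comment> \<open>The extra degree of the second implication: k < m \<le> n + 1 allows k =
      n.\<close>
    have "k \<le> n" using m k by simp
    then have W: "\<exists>D\<in>compact_subsets T. C \<subseteq> D \<and>
        R.inessential (tr ?P (C <#>\<^bsub>\<Gamma>\<^esub> \<Lambda>) (Suc k)) (tr ?P (D <#>\<^bsub>\<Gamma>\<^esub> \<Lambda>) (Suc (Suc k)))"
      if "C \<in> compact_subsets T" for C
      using Y[rule_format, OF k] that by (rule saturated_filtration_acyclic)
    obtain C where C: "C \<in> compact_subsets T" "F \<subseteq> coset ` C" using lift[OF F] by (rule bexE)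
    have "\<exists>D\<in>compact_subsets T. C \<subseteq> D \<and>
        R.inessential (trq ?P (coset ` C) (Suc k)) (trq ?P (coset ` D) (Suc (Suc k)))"
      using W C(1) by (rule coset_filtration_acyclic)
    then obtain D where D: "D \<in> compact_subsets T" "C \<subseteq> D"
      "R.inessential (trq ?P (coset ` C) (Suc k)) (trq ?P (coset ` D) (Suc (Suc k)))"
      by (elim bexE conjE) (rule that)
    have "R.inessential (trq ?P F (Suc k)) (trq ?P (coset ` D) (Suc (Suc k)))"
      by (rule R.inessential_mono[OF D(3) translates_mono[OF order_refl C(2)] order_refl])
    moreover have "F \<subseteq> coset ` D" using C(2) image_mono[OF D(2)] by (rule order_trans)
    ultimately show "\<exists>F'\<in>?KF. F \<subseteq> F' \<and> R.inessential (trq ?P F (Suc k)) (trq ?P F' (Suc (Suc k)))"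
      using KF[OF D(1)] by (intro bexI[of _ "coset ` D"] conjI)
  qed
qed

end
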